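(* Let $G$ be a finite nilpotent group whose order is free of 8-th powers (that is, $|G|$ is not divisible by $q^8$ for any prime $q$), and let $[c]\in H^2(G,\mathbb{C}^* )$ be a non-degenerate class. Then $[c]$ admits a normal Lagrangian. Consequently, every nilpotent group of central type $G$ whose order is free of 8-th powers admits a short exact sequence of groups $1\to A\to G\to Q\to 1$, where $A$ is abelian of order $\sqrt{|G|}$ and $Q$ is an IYB group.
   Context: $\mathbb{C}^*$ is regarded as a trivial $G$-module. A 2-cocycle $c\in Z^2(G,\mathbb{C}^* )$ is a map $c:G\times G\to\mathbb{C}^*$ with $c(g,h)c(gh,k)=c(g,hk)c(h,k)$ for all $g,h,k\in G$, and $[c]$ denotes its cohomology class. A subgroup $H$ of $G$ is isotropic with respect to $[c]$ if $\mathrm{res}^G_H[c]=0$ in $H^2(H,\mathbb{C}^* )$. The class $[c]$ (or the cocycle $c$) is non-degenerate if for every $x\in G$ with $x\neq e$ there is $g\in C_G(x)$ such that $c(x,g)\neq c(g,x)$; this depends only on the class $[c]$. If $[c]$ is non-degenerate, then $|G|$ is a perfect square. A Lagrangian with respect to a non-degenerate class $[c]$ is a subgroup $H$ of $G$ which is isotropic with respect to $[c]$ and satisfies $|H|=\sqrt{|G|}$; a normal Lagrangian is a Lagrangian which is a normal subgroup of $G$. A finite group is of central type if it has a non-degenerate class in $H^2(G,\mathbb{C}^* )$. A finite group $Q$ is an IYB (involutive Yang-Baxter) group if there exist a $Q$-module $M$ (an abelian group with an action of $Q$ by automorphisms) and a bijective 1-cocycle $\pi:Q\to M$, i.e. a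 bijection with $\pi(q_1q_2)=\pi(q_1)+q_1\cdot\pi(q_2)$ for all $q_1,q_2\in Q$. *)

theory Defs
  imports Complex_Main "HOL-Algebra.Generated_Groups" "HOL-Algebra.Bij" "HOL-Computational_Algebra.Primes"
begin

section \<open>The second cohomology group with coefficients in the nonzero complex numbers\<close>

text \<open>Cochains on \<open>G\<close> are extensional, i.e. \<open>undefined\<close> outside of the carrier, so that
  two cochains that agree on the group are equal.\<close>

definition two_cocycles :: "('a, 'b) monoid_scheme \<Rightarrow> ('a \<times> 'a \<Rightarrow> complex) set" where
  "two_cocycles G =
     {c \<in> carrier G \<times> carrier G \<rightarrow>\<^sub>E UNIV - {0}.
        \<forall>g\<in>carrier G. \<forall>h\<in>carrier G. \<forall>k\<in>carrier G.
          c (g, h) * c (g \<otimes>\<^bsub>G\<^esub> h, k) = c (g, h \<otimes>\<^bsub>G\<^esub> k) * c (h, k)}"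

definition Z2 :: "('a, 'b) monoid_scheme \<Rightarrow> ('a \<times> 'a \<Rightarrow> complex) monoid" where
  "Z2 G = \<lparr>carrier = two_cocycles G,
           monoid.mult = (\<lambda>c d. \<lambda>x\<in>carrier G \<times> carrier G. c x * d x),
           one = (\<lambda>x\<in>carrier G \<times> carrier G. 1)\<rparr>"

definition coboundary :: "('a, 'b) monoid_scheme \<Rightarrow> ('a \<Rightarrow> complex) \<Rightarrow> 'a \<times> 'a \<Rightarrow> complex" where
  "coboundary G f = (\<lambda>(g, h)\<in>carrier G \<times> carrier G. f g * f h / f (g \<otimes>\<^bsub>G\<^esub> h))"

definition two_coboundaries :: "('a, 'b) monoid_scheme \<Rightarrow> ('a \<times> 'a \<Rightarrow> complex) set" where
  "two_coboundaries G = coboundary G ` (carrier G \<rightarrow> UNIV - {0})"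

definition H2 :: "('a, 'b) monoid_scheme \<Rightarrow> ('a \<times> 'a \<Rightarrow> complex) set monoid" where
  "H2 G = Z2 G Mod two_coboundaries G"

definition cohomology_class ::
    "('a, 'b) monoid_scheme \<Rightarrow> ('a \<times> 'a \<Rightarrow> complex) \<Rightarrow> ('a \<times> 'a \<Rightarrow> complex) set" where
  "cohomology_class G c = two_coboundaries G #>\<^bsub>Z2 G\<^esub> c"

text \<open>The classes in the union below all coincide, see \<open>res_cohomology_class\<close>.\<close>

definition res :: "('a, 'b) monoid_scheme \<Rightarrow> 'a set \<Rightarrow>
    ('a \<times> 'a \<Rightarrow> complex) set \<Rightarrow> ('a \<times> 'a \<Rightarrow> complex) set" where
  "res G H \<gamma> = (\<Union>c\<in>\<gamma>. cohomology_class (G\<lparr>carrier := H\<rparr>) (restrict c (H \<times> H)))"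

section \<open>Isotropic subgroups, non-degeneracy and Lagrangians\<close>

definition isotropic :: "('a, 'b) monoid_scheme \<Rightarrow> ('a \<times> 'a \<Rightarrow> complex) set \<Rightarrow> 'a set \<Rightarrow> bool" where
  "isotropic G \<gamma> H \<longleftrightarrow> subgroup H G \<and> res G H \<gamma> = \<one>\<^bsub>H2 (G\<lparr>carrier := H\<rparr>)\<^esub>"

definition centralizer :: "('a, 'b) monoid_scheme \<Rightarrow> 'a \<Rightarrow> 'a set" where
  "centralizer G x = {g \<in> carrier G. g \<otimes>\<^bsub>G\<^esub> x = x \<otimes>\<^bsub>G\<^esub> g}"

definition nondegenerate_cocycle ::
    "('a, 'b) monoid_scheme \<Rightarrow> ('a \<times> 'a \<Rightarrow> complex) \<Rightarrow> bool" where
  "nondegenerate_cocycle G c \<longleftrightarrow>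
     (\<forall>x\<in>carrier G. x \<noteq> \<one>\<^bsub>G\<^esub> \<longrightarrow> (\<exists>g\<in>centralizer G x. c (x, g) \<noteq> c (g, x)))"

text \<open>Non-degeneracy does not depend on the representative, see
  \<open>nondegenerate_cohomology_class\<close>.\<close>

definition nondegenerate ::
    "('a, 'b) monoid_scheme \<Rightarrow> ('a \<times> 'a \<Rightarrow> complex) set \<Rightarrow> bool" where
  "nondegenerate G \<gamma> \<longleftrightarrow> (\<forall>c\<in>\<gamma>. nondegenerate_cocycle G c)"

definition lagrangian :: "('a, 'b) monoid_scheme \<Rightarrow> ('a \<times> 'a \<Rightarrow> complex) set \<Rightarrow> 'a set \<Rightarrow> bool" where
  "lagrangian G \<gamma> H \<longleftrightarrow> isotropic G \<gamma> H \<and> real (card H) = sqrt (real (Coset.order G))"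

definition normal_lagrangian ::
    "('a, 'b) monoid_scheme \<Rightarrow> ('a \<times> 'a \<Rightarrow> complex) set \<Rightarrow> 'a set \<Rightarrow> bool" where
  "normal_lagrangian G \<gamma> H \<longleftrightarrow> lagrangian G \<gamma> H \<and> H \<lhd> G"

definition central_type :: "('a, 'b) monoid_scheme \<Rightarrow> bool" where
  "central_type G \<longleftrightarrow>
     group G \<and> finite (carrier G) \<and> (\<exists>\<gamma>\<in>carrier (H2 G). nondegenerate G \<gamma>)"

section \<open>Nilpotent groups, short exact sequences and IYB groups\<close>

primrec lower_central :: "('a, 'b) monoid_scheme \<Rightarrow> nat \<Rightarrow> 'a set" where
  "lower_central G 0 = carrier G"
| "lower_central G (Suc n) =
     generate G (\<Union>h\<in>lower_central G n. \<Union>g\<in>carrier G.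
       {h \<otimes>\<^bsub>G\<^esub> g \<otimes>\<^bsub>G\<^esub> inv\<^bsub>G\<^esub> h \<otimes>\<^bsub>G\<^esub> inv\<^bsub>G\<^esub> g})"

definition nilpotent_group :: "('a, 'b) monoid_scheme \<Rightarrow> bool" where
  "nilpotent_group G \<longleftrightarrow> group G \<and> (\<exists>n. lower_central G n = {\<one>\<^bsub>G\<^esub>})"

text \<open>\<open>1 \<rightarrow> A \<rightarrow> G \<rightarrow> Q \<rightarrow> 1\<close> with maps \<open>i\<close> and \<open>p\<close>. The library's
  \<open>exact_seq\<close> forces all groups to have the same carrier type.\<close>

definition short_exact :: "('a, 'm) monoid_scheme \<Rightarrow> ('a \<Rightarrow> 'b) \<Rightarrow> ('b, 'n) monoid_scheme \<Rightarrow>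
    ('b \<Rightarrow> 'c) \<Rightarrow> ('c, 'k) monoid_scheme \<Rightarrow> bool" where
  "short_exact A i G p Q \<longleftrightarrow>
     group_hom A G i \<and> group_hom G Q p \<and>
     inj_on i (carrier A) \<and> i ` carrier A = kernel G Q p \<and> p ` carrier G = carrier Q"

text \<open>The module \<open>M\<close> is written multiplicatively, and \<open>\<phi>\<close> is the action of \<open>Q\<close> on it.\<close>

definition bijective_cocycle :: "('a, 'm) monoid_scheme \<Rightarrow> ('c, 'n) monoid_scheme \<Rightarrow>
    ('a \<Rightarrow> 'c \<Rightarrow> 'c) \<Rightarrow> ('a \<Rightarrow> 'c) \<Rightarrow> bool" where
  "bijective_cocycle Q M \<phi> \<pi> \<longleftrightarrow>
     comm_group M \<and> \<phi> \<in> hom Q (AutoGroup M) \<and> bij_betw \<pi> (carrier Q) (carrier M) \<and>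
     (\<forall>x\<in>carrier Q. \<forall>y\<in>carrier Q. \<pi> (x \<otimes>\<^bsub>Q\<^esub> y) = \<pi> x \<otimes>\<^bsub>M\<^esub> \<phi> x (\<pi> y))"

text \<open>A type cannot be quantified existentially, so \<open>M\<close> has the carrier type of \<open>Q\<close> here.
  This is no restriction since \<open>M\<close> is in bijection with \<open>Q\<close>, see \<open>IYB_groupI\<close>.\<close>

definition IYB_group :: "('a, 'b) monoid_scheme \<Rightarrow> bool" where
  "IYB_group Q \<longleftrightarrow> group Q \<and> finite (carrier Q) \<and>
     (\<exists>(M :: 'a monoid) \<phi> \<pi>. bijective_cocycle Q M \<phi> \<pi>)"

section \<open>Well-definedness\<close>

lemma two_cocycles_nonzero:
  "c \<in> two_cocycles G \<Longrightarrow> g \<in> carrier G \<Longrightarrow> h \<in> carrier G \<Longrightarrow> c (g, h) \<noteq> 0"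
  by (auto simp: two_cocycles_def PiE_def Pi_def)

lemma comm_group_Z2:
  assumes "group G"
  shows "comm_group (Z2 G)"
proof -
  interpret G: group G by fact
  show ?thesis
  proof (rule comm_groupI)
    fix c d assume "c \<in> carrier (Z2 G)" "d \<in> carrier (Z2 G)"
    then have c: "c \<in> two_cocycles G" and d: "d \<in> two_cocycles G" by (simp_all add: Z2_def)
    have "c (g, h) * d (g, h) * (c (g \<otimes>\<^bsub>G\<^esub> h, k) * d (g \<otimes>\<^bsub>G\<^esub> h, k)) =
        c (g, h \<otimes>\<^bsub>G\<^esub> k) * d (g, h \<otimes>\<^bsub>G\<^esub> k) * (c (h, k) * d (h, k))"
      if "g \<in> carrier G" "h \<in> carrier G" "k \<in> carrier G" for g h k
    proof -
      have "c (g, h) * c (g \<otimes>\<^bsub>G\<^esub> h, k) = c (g, h \<otimes>\<^bsub>G\<^esub> k) * c (h, k)"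
        using c that by (simp add: two_cocycles_def)
      moreover have "d (g, h) * d (g \<otimes>\<^bsub>G\<^esub> h, k) = d (g, h \<otimes>\<^bsub>G\<^esub> k) * d (h, k)"
        using d that by (simp add: two_cocycles_def)
      ultimately show ?thesis by algebra
    qed
    with two_cocycles_nonzero[OF c] two_cocycles_nonzero[OF d]
    show "c \<otimes>\<^bsub>Z2 G\<^esub> d \<in> carrier (Z2 G)"
      by (auto simp: Z2_def two_cocycles_def)
    show "c \<otimes>\<^bsub>Z2 G\<^esub> d = d \<otimes>\<^bsub>Z2 G\<^esub> c"
      by (auto simp: Z2_def fun_eq_iff restrict_def)
  next
    show "\<one>\<^bsub>Z2 G\<^esub> \<in> carrier (Z2 G)" by (auto simp: Z2_def two_cocycles_def)
  next
    fix c d e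
    show "c \<otimes>\<^bsub>Z2 G\<^esub> d \<otimes>\<^bsub>Z2 G\<^esub> e = c \<otimes>\<^bsub>Z2 G\<^esub> (d \<otimes>\<^bsub>Z2 G\<^esub> e)"
      by (auto simp: Z2_def fun_eq_iff restrict_def)
  next
    fix c assume "c \<in> carrier (Z2 G)"
    then have c: "c \<in> two_cocycles G" by (simp add: Z2_def)
    then have "c \<in> extensional (carrier G \<times> carrier G)"
      by (auto simp: two_cocycles_def PiE_def)
    then show "\<one>\<^bsub>Z2 G\<^esub> \<otimes>\<^bsub>Z2 G\<^esub> c = c"
      by (auto simp: Z2_def fun_eq_iff restrict_def extensional_def)
    let ?d = "\<lambda>x\<in>carrier G \<times> carrier G. inverse (c x)"
    have "inverse (c (g, h)) * inverse (c (g \<otimes>\<^bsub>G\<^esub> h, k)) =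
        inverse (c (g, h \<otimes>\<^bsub>G\<^esub> k)) * inverse (c (h, k))"
      if "g \<in> carrier G" "h \<in> carrier G" "k \<in> carrier G" for g h k
    proof -
      have "c (g, h) * c (g \<otimes>\<^bsub>G\<^esub> h, k) = c (g, h \<otimes>\<^bsub>G\<^esub> k) * c (h, k)"
        using c that by (simp add: two_cocycles_def)
      then show ?thesis by (metis inverse_mult_distrib)
    qed
    with two_cocycles_nonzero[OF c] have "?d \<in> carrier (Z2 G)"
      by (auto simp: Z2_def two_cocycles_def)
    moreover have "?d \<otimes>\<^bsub>Z2 G\<^esub> c = \<one>\<^bsub>Z2 G\<^esub>"
      using two_cocycles_nonzero[OF c] by (auto simp: Z2_def fun_eq_iff restrict_def)
    ultimately show "\<exists>d\<in>carrier (Z2 G). d \<otimes>\<^bsub>Z2 G\<^esub> c = \<one>\<^bsub>Z2 G\<^esub>" by blast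
  qed
qed

lemma coboundary_mult:
  "coboundary G f \<otimes>\<^bsub>Z2 G\<^esub> coboundary G f' = coboundary G (\<lambda>g. f g * f' g)"
  by (auto simp: Z2_def coboundary_def fun_eq_iff restrict_def)

lemma coboundary_in_Z2:
  assumes "group G" "f \<in> carrier G \<rightarrow> UNIV - {0}"
  shows "coboundary G f \<in> carrier (Z2 G)"
proof -
  interpret G: group G by fact
  have nz: "f g \<noteq> 0" if "g \<in> carrier G" for g using assms(2) that by auto
  have "f g * f h / f (g \<otimes>\<^bsub>G\<^esub> h) * (f (g \<otimes>\<^bsub>G\<^esub> h) * f k / f (g \<otimes>\<^bsub>G\<^esub> h \<otimes>\<^bsub>G\<^esub> k)) =
      f g * f (h \<otimes>\<^bsub>G\<^esub> k) / f (g \<otimes>\<^bsub>G\<^esub> (h \<otimes>\<^bsub>G\<^esub> k)) * (f h * f k / f (h \<otimes>\<^bsub>G\<^esub> k))"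
    if "g \<in> carrier G" "h \<in> carrier G" "k \<in> carrier G" for g h k
    using that nz by (simp add: G.m_assoc)
  with nz show ?thesis
    by (auto simp: Z2_def two_cocycles_def coboundary_def)
qed

lemma subgroup_two_coboundaries:
  assumes "group G"
  shows "subgroup (two_coboundaries G) (Z2 G)"
proof -
  interpret G: group G by fact
  interpret Z: comm_group "Z2 G" by (rule comm_group_Z2) fact
  have one: "coboundary G (\<lambda>_. 1) = \<one>\<^bsub>Z2 G\<^esub>"
    by (auto simp: Z2_def coboundary_def fun_eq_iff restrict_def)
  show ?thesis
  proof (rule Z.subgroupI)
    show "two_coboundaries G \<subseteq> carrier (Z2 G)"
      using coboundary_in_Z2[OF assms] by (auto simp: two_coboundaries_def)
    show "two_coboundaries G \<noteq> {}"
    proof -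
      have "(\<lambda>_. 1) \<in> carrier G \<rightarrow> UNIV - {0::complex}" by simp
      then show ?thesis unfolding two_coboundaries_def by blast
    qed
  next
    fix b assume "b \<in> two_coboundaries G"
    then obtain f where f: "f \<in> carrier G \<rightarrow> UNIV - {0}" and b: "b = coboundary G f"
      by (auto simp: two_coboundaries_def)
    let ?f = "\<lambda>g. inverse (f g)"
    have f': "?f \<in> carrier G \<rightarrow> UNIV - {0}" using f by auto
    have "coboundary G ?f \<otimes>\<^bsub>Z2 G\<^esub> b = coboundary G (\<lambda>g. ?f g * f g)"
      by (simp add: b coboundary_mult)
    also have "\<dots> = coboundary G (\<lambda>_. 1)"
      using f by (auto simp: coboundary_def fun_eq_iff restrict_def Pi_def)
    finally have "inv\<^bsub>Z2 G\<^esub> b = coboundary G ?f"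
      using coboundary_in_Z2[OF assms] f f' b one by (metis Z.inv_equality)
    with f' show "inv\<^bsub>Z2 G\<^esub> b \<in> two_coboundaries G" by (auto simp: two_coboundaries_def)
  next
    fix b b' assume "b \<in> two_coboundaries G" "b' \<in> two_coboundaries G"
    then obtain f f' where "f \<in> carrier G \<rightarrow> UNIV - {0}" "b = coboundary G f"
      "f' \<in> carrier G \<rightarrow> UNIV - {0}" "b' = coboundary G f'"
      by (auto simp: two_coboundaries_def)
    then show "b \<otimes>\<^bsub>Z2 G\<^esub> b' \<in> two_coboundaries G"
      by (auto simp: two_coboundaries_def coboundary_mult intro!: imageI)
  qed
qed

lemma comm_group_H2:
  assumes "group G"
  shows "comm_group (H2 G)"
  unfolding H2_def
  by (rule comm_group.abelian_FactGroup[OF comm_group_Z2 subgroup_two_coboundaries]) fact+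

lemma carrier_H2: "carrier (H2 G) = cohomology_class G ` two_cocycles G"
  by (auto simp: H2_def carrier_FactGroup cohomology_class_def Z2_def)

lemma mem_cohomology_class_iff:
  assumes "group G" "c \<in> two_cocycles G"
  shows "d \<in> cohomology_class G c \<longleftrightarrow>
    d \<in> two_cocycles G \<and> cohomology_class G d = cohomology_class G c"
proof -
  interpret Z: comm_group "Z2 G" by (rule comm_group_Z2) fact
  interpret B: subgroup "two_coboundaries G" "Z2 G"
    by (rule subgroup_two_coboundaries) fact
  have C: "carrier (Z2 G) = two_cocycles G" by (simp add: Z2_def)
  show ?thesis
    unfolding cohomology_class_def using assms(2) C
    by (metis B.elemrcos_carrier B.subgroup_axioms Z.is_group Z.repr_independence Z.rcos_self)
qed

lemma restrict_two_cocycles: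
  assumes "group G" "subgroup H G" "c \<in> two_cocycles G"
  shows "restrict c (H \<times> H) \<in> two_cocycles (G\<lparr>carrier := H\<rparr>)"
proof -
  have "H \<subseteq> carrier G" using assms(2) by (rule subgroup.subset)
  moreover have "x \<otimes>\<^bsub>G\<^esub> y \<in> H" if "x \<in> H" "y \<in> H" for x y
    using assms(2) that by (rule subgroup.m_closed)
  ultimately show ?thesis
    using two_cocycles_nonzero[OF assms(3)] assms(3)
    by (auto simp: two_cocycles_def subset_iff)
qed

lemma res_cohomology_class:
  assumes "group G" "subgroup H G" "c \<in> two_cocycles G"
  shows "res G H (cohomology_class G c) =
    cohomology_class (G\<lparr>carrier := H\<rparr>) (restrict c (H \<times> H))"
proof -
  let ?H = "G\<lparr>carrier := H\<rparr>"
  interpret G: group G by fact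
  interpret H: group ?H using assms(2) by (rule G.subgroup_imp_group)
  have sub: "H \<subseteq> carrier G" using assms(2) by (rule subgroup.subset)
  have cl: "x \<otimes>\<^bsub>G\<^esub> y \<in> H" if "x \<in> H" "y \<in> H" for x y
    using assms(2) that by (rule subgroup.m_closed)
  have eq: "cohomology_class ?H (restrict d (H \<times> H)) = cohomology_class ?H (restrict c (H \<times> H))"
    if "d \<in> cohomology_class G c" for d
  proof -
    from that obtain f where f: "f \<in> carrier G \<rightarrow> UNIV - {0}"
      and d: "d = coboundary G f \<otimes>\<^bsub>Z2 G\<^esub> c"
      by (auto simp: cohomology_class_def two_coboundaries_def r_coset_def)
    have "restrict d (H \<times> H) = coboundary ?H f \<otimes>\<^bsub>Z2 ?H\<^esub> restrict c (H \<times> H)"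
      using sub by (auto simp: d Z2_def coboundary_def fun_eq_iff restrict_def)
    moreover have "coboundary ?H f \<in> two_coboundaries ?H"
      using f sub by (auto simp: two_coboundaries_def intro!: imageI)
    ultimately have "restrict d (H \<times> H) \<in> cohomology_class ?H (restrict c (H \<times> H))"
      by (auto simp: cohomology_class_def r_coset_def)
    then show ?thesis
      using mem_cohomology_class_iff[OF H.is_group restrict_two_cocycles[OF assms]] by blast
  qed
  moreover have "c \<in> cohomology_class G c"
    using mem_cohomology_class_iff[OF assms(1,3)] assms(3) by blast
  ultimately show ?thesis
    unfolding res_def by blast
qed

lemma isotropic_cohomology_class:
  assumes "group G" "subgroup H G" "c \<in> two_cocycles G"
  shows "isotropic G (cohomology_class G c) H \<longleftrightarrow>
    restrict c (H \<times> H) \<in> two_coboundaries (G\<lparr>carrier := H\<rparr>)"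
proof -
  let ?H = "G\<lparr>carrier := H\<rparr>"
  interpret G: group G by fact
  interpret H: group ?H using assms(2) by (rule G.subgroup_imp_group)
  interpret Z: comm_group "Z2 ?H" by (rule comm_group_Z2) (rule H.is_group)
  have B: "subgroup (two_coboundaries ?H) (Z2 ?H)"
    by (rule subgroup_two_coboundaries) (rule H.is_group)
  have "restrict c (H \<times> H) \<in> carrier (Z2 ?H)"
    using restrict_two_cocycles[OF assms] by (simp add: Z2_def)
  then have "cohomology_class ?H (restrict c (H \<times> H)) = two_coboundaries ?H \<longleftrightarrow>
      restrict c (H \<times> H) \<in> two_coboundaries ?H"
    unfolding cohomology_class_def
    using Z.coset_join1[OF _ _ B] Z.coset_join2[OF _ B] by blast
  then show ?thesis
    by (simp add: isotropic_def assms(2) res_cohomology_class[OF assms] H2_def)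
qed

lemma nondegenerate_cohomology_class:
  assumes "group G" "c \<in> two_cocycles G"
  shows "nondegenerate G (cohomology_class G c) \<longleftrightarrow> nondegenerate_cocycle G c"
proof -
  have "nondegenerate_cocycle G d"
    if nd: "nondegenerate_cocycle G c" and "d \<in> cohomology_class G c" for d
    unfolding nondegenerate_cocycle_def
  proof (intro ballI impI)
    fix x assume x: "x \<in> carrier G" "x \<noteq> \<one>\<^bsub>G\<^esub>"
    from that obtain f where f: "f \<in> carrier G \<rightarrow> UNIV - {0}"
      and d: "d = coboundary G f \<otimes>\<^bsub>Z2 G\<^esub> c"
      by (auto simp: cohomology_class_def two_coboundaries_def r_coset_def)
    obtain g where g: "g \<in> carrier G" "g \<otimes>\<^bsub>G\<^esub> x = x \<otimes>\<^bsub>G\<^esub> g" "c (x, g) \<noteq> c (g, x)"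
      using nd x by (auto simp: nondegenerate_cocycle_def centralizer_def)
    have "x \<otimes>\<^bsub>G\<^esub> g \<in> carrier G"
      using assms(1) x(1) g(1) by (simp add: group.is_monoid monoid.m_closed)
    with f x(1) g(1) have "f x \<noteq> 0" "f g \<noteq> 0" "f (x \<otimes>\<^bsub>G\<^esub> g) \<noteq> 0" by auto
    with x(1) g have "d (x, g) \<noteq> d (g, x)"
      by (simp add: d Z2_def coboundary_def)
    with g show "\<exists>g\<in>centralizer G x. d (x, g) \<noteq> d (g, x)"
      by (auto simp: centralizer_def)
  qed
  moreover have "c \<in> cohomology_class G c"
    using mem_cohomology_class_iff[OF assms] assms(2) by blast
  ultimately show ?thesis by (auto simp: nondegenerate_def)
qed

lemma IYB_groupI:
  fixes Q :: "('a, 'm) monoid_scheme" and M :: "('c, 'n) monoid_scheme"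
  assumes "group Q" "finite (carrier Q)" "bijective_cocycle Q M \<phi> \<pi>"
  shows "IYB_group Q"
proof -
  interpret Q: group Q by fact
  interpret M: comm_group M using assms(3) by (simp add: bijective_cocycle_def)
  have coc: "\<pi> (x \<otimes>\<^bsub>Q\<^esub> y) = \<pi> x \<otimes>\<^bsub>M\<^esub> \<phi> x (\<pi> y)" if "x \<in> carrier Q" "y \<in> carrier Q" for x y
    using assms(3) that by (auto simp: bijective_cocycle_def)
  have hom: "\<phi> \<in> hom Q (AutoGroup M)" using assms(3) by (auto simp: bijective_cocycle_def)
  have bij: "bij_betw \<pi> (carrier Q) (carrier M)" using assms(3) by (auto simp: bijective_cocycle_def)
  define \<rho> where "\<rho> = inv_into (carrier Q) \<pi>"
  have \<pi>c: "\<pi> x \<in> carrier M" if "x \<in> carrier Q" for x using bij that by (auto simp: bij_betw_def)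
  have \<rho>c: "\<rho> m \<in> carrier Q" if "m \<in> carrier M" for m
    unfolding \<rho>_def using bij that by (metis bij_betw_def inv_into_into)
  have \<pi>\<rho>: "\<pi> (\<rho> m) = m" if "m \<in> carrier M" for m
    unfolding \<rho>_def using bij that by (metis bij_betw_def f_inv_into_f)
  have \<rho>\<pi>: "\<rho> (\<pi> x) = x" if "x \<in> carrier Q" for x
    unfolding \<rho>_def using bij that by (metis bij_betw_def inv_into_f_f)
  have \<phi>a: "\<phi> x \<in> auto M" if "x \<in> carrier Q" for x
    using hom that by (auto simp: hom_def AutoGroup_def)
  have \<phi>m: "\<phi> (x \<otimes>\<^bsub>Q\<^esub> y) = compose (carrier M) (\<phi> x) (\<phi> y)"
    if "x \<in> carrier Q" "y \<in> carrier Q" for x y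
    using hom that \<phi>a[OF that(1)] \<phi>a[OF that(2)]
    by (auto simp: hom_def AutoGroup_def BijGroup_def auto_def)
  have \<phi>c: "\<phi> x m \<in> carrier M" if "x \<in> carrier Q" "m \<in> carrier M" for x m
    using \<phi>a[OF that(1)] that(2) by (auto simp: auto_def hom_def)
  have \<phi>h: "\<phi> x (m \<otimes>\<^bsub>M\<^esub> n) = \<phi> x m \<otimes>\<^bsub>M\<^esub> \<phi> x n"
    if "x \<in> carrier Q" "m \<in> carrier M" "n \<in> carrier M" for x m n
    using \<phi>a[OF that(1)] that(2,3) by (auto simp: auto_def hom_def)
  define N :: "'a monoid" where
    "N = \<lparr>carrier = carrier Q, monoid.mult = (\<lambda>x y. \<rho> (\<pi> x \<otimes>\<^bsub>M\<^esub> \<pi> y)), one = \<rho> \<one>\<^bsub>M\<^esub>\<rparr>"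
  have N: "comm_group N"
  proof (rule comm_groupI)
    fix x assume x: "x \<in> carrier N"
    then have "\<rho> (inv\<^bsub>M\<^esub> \<pi> x) \<in> carrier N" "\<rho> (inv\<^bsub>M\<^esub> \<pi> x) \<otimes>\<^bsub>N\<^esub> x = \<one>\<^bsub>N\<^esub>"
      by (simp_all add: N_def \<pi>c \<rho>c \<pi>\<rho>)
    then show "\<exists>y\<in>carrier N. y \<otimes>\<^bsub>N\<^esub> x = \<one>\<^bsub>N\<^esub>" by blast
  qed (auto simp: N_def \<pi>c \<rho>c \<pi>\<rho> \<rho>\<pi> M.m_ac)
  define \<psi> where "\<psi> x = (\<lambda>y\<in>carrier Q. \<rho> (\<phi> x (\<pi> y)))" for x
  have \<psi>a: "\<psi> x \<in> auto N" if x: "x \<in> carrier Q" for x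
  proof -
    have "bij_betw (\<phi> x) (carrier M) (carrier M)" using \<phi>a[OF x] by (auto simp: auto_def Bij_def)
    moreover have "bij_betw \<rho> (carrier M) (carrier Q)"
      unfolding \<rho>_def using bij by (rule bij_betw_inv_into)
    ultimately have "bij_betw (\<rho> \<circ> (\<phi> x \<circ> \<pi>)) (carrier Q) (carrier Q)"
      using bij by (blast intro: bij_betw_trans)
    then have "bij_betw (\<psi> x) (carrier Q) (carrier Q)"
      by (rule bij_betw_cong[THEN iffD1, rotated]) (simp add: \<psi>_def)
    then show ?thesis
      using x by (auto simp: auto_def Bij_def hom_def N_def \<psi>_def \<pi>c \<rho>c \<pi>\<rho> \<phi>c \<phi>h)
  qed
  have "\<psi> \<in> hom Q (AutoGroup N)"
  proof (rule homI)
    show "\<psi> x \<in> carrier (AutoGroup N)" if "x \<in> carrier Q" for x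
      using \<psi>a[OF that] by (simp add: AutoGroup_def)
    show "\<psi> (x \<otimes>\<^bsub>Q\<^esub> y) = \<psi> x \<otimes>\<^bsub>AutoGroup N\<^esub> \<psi> y" if "x \<in> carrier Q" "y \<in> carrier Q" for x y
    proof -
      have "\<psi> x \<otimes>\<^bsub>AutoGroup N\<^esub> \<psi> y = compose (carrier N) (\<psi> x) (\<psi> y)"
        using \<psi>a[OF that(1)] \<psi>a[OF that(2)] by (auto simp: AutoGroup_def BijGroup_def auto_def)
      moreover have "\<psi> (x \<otimes>\<^bsub>Q\<^esub> y) = compose (carrier N) (\<psi> x) (\<psi> y)"
        using that
        by (auto simp: fun_eq_iff \<psi>_def \<phi>m compose_def N_def restrict_def \<pi>c \<rho>c \<pi>\<rho> \<phi>c)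
      ultimately show ?thesis by simp
    qed
  qed
  moreover have "bij_betw (\<lambda>x. x) (carrier Q) (carrier N)" by (simp add: N_def bij_betw_def)
  moreover have "x \<otimes>\<^bsub>Q\<^esub> y = x \<otimes>\<^bsub>N\<^esub> \<psi> x y" if "x \<in> carrier Q" "y \<in> carrier Q" for x y
  proof -
    have "x \<otimes>\<^bsub>N\<^esub> \<psi> x y = \<rho> (\<pi> (x \<otimes>\<^bsub>Q\<^esub> y))"
      using that by (simp add: N_def \<psi>_def \<pi>c \<pi>\<rho> \<phi>c coc)
    with that show ?thesis by (simp add: \<rho>\<pi>)
  qed
  ultimately have "bijective_cocycle Q N \<psi> (\<lambda>x. x)"
    using N by (simp add: bijective_cocycle_def)
  with assms(1,2) show ?thesis unfolding IYB_group_def by blast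
qed

end

theory Submission
  imports Defs "HOL-Algebra.Sylow" "HOL-Algebra.Multiplicative_Group"
begin

text \<open>
  Let \<open>u\<^sub>g\<close> be the basis of the twisted group algebra, \<open>u\<^sub>g u\<^sub>h = c(g,h) u\<^sub>g\<^sub>h\<close>. Conjugation by \<open>u\<^sub>g\<close>
  sends \<open>u\<^sub>x\<close> to a multiple of the basis element at \<open>g x g\<^sup>-\<^sup>1\<close>; the factor is \<open>twist g x\<close>. All that is
  used of nondegeneracy is that this algebra has only scalars in its center, in the form of
  \<open>twisted_class_sum\<close>: a sum of all conjugates of any element has no component outside of the
  identity.

  Let \<open>A\<close> be a normal isotropic subgroup. After multiplying \<open>c\<close> by a coboundary
  (\<open>normalized_representative\<close>) it is trivial on \<open>A \<times> G\<close>. Then \<open>\<Sum>a\<in>A. u\<^sub>a\<close> is a multiple of the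
  idempotent of the trivial character of \<open>A\<close>, and \<open>G\<close> permutes such idempotents. Since the sum over
  the orbit is central, it is a scalar; hence \<open>A\<close> is abelian (\<open>A_commute\<close>), every character of \<open>A\<close> is
  in the orbit, and the stabilizer \<open>stab\<close> of the trivial character has order \<open>|G| / |A|\<close>
  (\<open>card_orbit_char_fibre\<close>). So \<open>A\<close> is Lagrangian if and only if \<open>stab = A\<close>, and in this case
  the orbit map is a bijective cocycle from \<open>G/A\<close> to the character group of \<open>A\<close>, which makes \<open>G/A\<close>
  an IYB group (\<open>IYB_quotient\<close>).

  For the existence of a normal Lagrangian let \<open>A\<close> be a normal isotropic subgroup of maximal order
  (\<open>maximal_isotropic_card\<close>) and let \<open>C\<close> be its centralizer. The radical \<open>stab \<inter> C\<close> is normal in \<open>G\<close>.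
  If it were larger than \<open>A\<close>, nilpotency would give an element \<open>m\<close> of it that is central modulo
  \<open>A\<close>, and \<open>A\<close> together with \<open>m\<close> would generate a larger normal isotropic subgroup
  (\<open>isotropic_adjoin\<close>). So the radical is \<open>A\<close>, which bounds the centralizer: \<open>|C|\<close> divides \<open>|A|\<^sup>2\<close>.
  Suppose that \<open>stab \<noteq> A\<close>. The class on \<open>stab / A\<close> is nondegenerate again, so that its order is
  divisible by \<open>p\<^sup>2\<close> for some prime \<open>p\<close> (\<open>prime_square_dvd_card_stab\<close>), and \<open>p\<^sup>2|A|\<^sup>2\<close> divides \<open>|G|\<close>.
  As \<open>|G|\<close> is free of 8-th powers, \<open>p\<^sup>3\<close> does not divide \<open>|A|\<close>. A \<open>p\<close>-part this small admits few
  automorphisms that come from a nilpotent group: \<open>p\<^sup>2\<close> does not divide the index of \<open>C\<close>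
  (\<open>centralizer_p_part\<close>). But then \<open>|C|\<close> contains a higher power of \<open>p\<close> than \<open>|A|\<^sup>2\<close> does.
\<close>

section \<open>Conjugation and adjoining an element to a normal subgroup\<close>

definition conj_by :: "('a, 'b) monoid_scheme \<Rightarrow> 'a \<Rightarrow> 'a \<Rightarrow> 'a" where
  "conj_by G g x = g \<otimes>\<^bsub>G\<^esub> x \<otimes>\<^bsub>G\<^esub> inv\<^bsub>G\<^esub> g"

context group
begin

lemma inv_mult_cancel [simp]:
  "x \<in> carrier G \<Longrightarrow> y \<in> carrier G \<Longrightarrow> inv x \<otimes> (x \<otimes> y) = y"
  by (simp flip: m_assoc)

lemma mult_inv_cancel [simp]:
  "x \<in> carrier G \<Longrightarrow> y \<in> carrier G \<Longrightarrow> x \<otimes> (inv x \<otimes> y) = y"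
  by (simp flip: m_assoc)

lemma conj_by_closed [simp]:
  "g \<in> carrier G \<Longrightarrow> x \<in> carrier G \<Longrightarrow> conj_by G g x \<in> carrier G"
  by (simp add: conj_by_def)

lemma conj_by_mult:
  "g \<in> carrier G \<Longrightarrow> x \<in> carrier G \<Longrightarrow> y \<in> carrier G \<Longrightarrow>
    conj_by G g (x \<otimes> y) = conj_by G g x \<otimes> conj_by G g y"
  by (simp add: conj_by_def m_assoc inv_solve_left)

lemma conj_by_conj_by:
  "g \<in> carrier G \<Longrightarrow> h \<in> carrier G \<Longrightarrow> x \<in> carrier G \<Longrightarrow>
    conj_by G g (conj_by G h x) = conj_by G (g \<otimes> h) x"
  by (simp add: conj_by_def m_assoc inv_mult_group)

lemma conj_by_one [simp]: "x \<in> carrier G \<Longrightarrow> conj_by G \<one> x = x"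
  by (simp add: conj_by_def)

lemma conj_by_one_right [simp]: "g \<in> carrier G \<Longrightarrow> conj_by G g \<one> = \<one>"
  by (simp add: conj_by_def)

lemma conj_by_inv_conj_by [simp]:
  "g \<in> carrier G \<Longrightarrow> x \<in> carrier G \<Longrightarrow> conj_by G (inv g) (conj_by G g x) = x"
  by (simp add: conj_by_conj_by)

lemma conj_by_conj_by_inv [simp]:
  "g \<in> carrier G \<Longrightarrow> x \<in> carrier G \<Longrightarrow> conj_by G g (conj_by G (inv g) x) = x"
  by (simp add: conj_by_conj_by)

lemma conj_by_inv:
  "g \<in> carrier G \<Longrightarrow> x \<in> carrier G \<Longrightarrow> conj_by G g (inv x) = inv (conj_by G g x)"
  by (simp add: conj_by_def m_assoc inv_mult_group)

lemma conj_by_pow: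
  "g \<in> carrier G \<Longrightarrow> x \<in> carrier G \<Longrightarrow> conj_by G g (x [^] (n::nat)) = conj_by G g x [^] n"
  by (induction n) (simp_all add: conj_by_mult)

lemma conj_by_mult_self:
  "g \<in> carrier G \<Longrightarrow> x \<in> carrier G \<Longrightarrow> conj_by G g x \<otimes> g = g \<otimes> x"
  by (simp add: conj_by_def m_assoc)

lemma conj_by_eq_self_iff:
  "g \<in> carrier G \<Longrightarrow> x \<in> carrier G \<Longrightarrow> conj_by G g x = x \<longleftrightarrow> g \<otimes> x = x \<otimes> g"
  by (metis conj_by_mult_self conj_by_closed right_cancel)

lemma conj_by_normal:
  "N \<lhd> G \<Longrightarrow> g \<in> carrier G \<Longrightarrow> x \<in> N \<Longrightarrow> conj_by G g x \<in> N"
  by (simp add: conj_by_def normal.inv_op_closed2)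

lemma normalI_conj_by:
  assumes "subgroup N G" "\<And>g x. g \<in> carrier G \<Longrightarrow> x \<in> N \<Longrightarrow> conj_by G g x \<in> N"
  shows "N \<lhd> G"
  using assms by (simp add: normal_inv_iff conj_by_def)

lemma subgroup_pow_closed:
  "subgroup H G \<Longrightarrow> x \<in> H \<Longrightarrow> x [^] (n::nat) \<in> H"
  by (induction n) (auto intro: subgroup.m_closed subgroup.one_closed)

text \<open>The condition \<open>conj_by G s m \<otimes> inv m \<in> N\<close> says that \<open>m\<close> commutes with \<open>s\<close> modulo \<open>N\<close>. It is
  used in this form, instead of through \<open>G Mod N\<close>, since \<open>s\<close> may be confined to a
  subgroup of \<open>G\<close>.\<close>

lemma central_mod_mult:
  assumes N: "N \<lhd> G" and s: "s \<in> carrier G" and m: "m \<in> carrier G" "m' \<in> carrier G"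
    and "conj_by G s m \<otimes> inv m \<in> N" "conj_by G s m' \<otimes> inv m' \<in> N"
  shows "conj_by G s (m \<otimes> m') \<otimes> inv (m \<otimes> m') \<in> N"
proof -
  interpret N: normal N G by fact
  have "conj_by G s (m \<otimes> m') \<otimes> inv (m \<otimes> m') =
      (conj_by G s m \<otimes> inv m) \<otimes> conj_by G m (conj_by G s m' \<otimes> inv m')"
    using s m by (simp add: conj_by_mult inv_mult_group) (simp add: conj_by_def m_assoc)
  then show ?thesis
    using assms conj_by_normal[OF N m(1)] by (simp add: N.m_closed)
qed

lemma central_mod_pow:
  assumes N: "N \<lhd> G" and s: "s \<in> carrier G" and m: "m \<in> carrier G"
    and "conj_by G s m \<otimes> inv m \<in> N"
  shows "conj_by G s (m [^] (n::nat)) \<otimes> inv (m [^] n) \<in> N"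
proof (induction n)
  case 0
  then show ?case using s by (simp add: normal_imp_subgroup[OF N] subgroup.one_closed)
next
  case (Suc n)
  then show ?case using central_mod_mult[OF N s _ m Suc assms(4)] m by simp
qed

text \<open>The subgroup generated by \<open>N\<close> and \<open>m\<close>, if \<open>N\<close> is normal and some positive power of \<open>m\<close> is in \<open>N\<close>.\<close>

definition adjoin :: "'a set \<Rightarrow> 'a \<Rightarrow> 'a set" where
  "adjoin N m = {a \<otimes> m [^] i |a (i::nat). a \<in> N}"

lemma adjoinI: "a \<in> N \<Longrightarrow> a \<otimes> m [^] (i::nat) \<in> adjoin N m"
  by (auto simp: adjoin_def)

lemma adjoin_reduce:
  assumes N: "N \<lhd> G" and m: "m \<in> carrier G" and p: "0 < (p::nat)" "m [^] p \<in> N" and a: "a \<in> N"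
  obtains b where "b \<in> N" "a \<otimes> m [^] (i::nat) = b \<otimes> m [^] (i mod p)"
proof
  interpret N: normal N G by fact
  have "a \<otimes> m [^] i = a \<otimes> (m [^] (p * (i div p)) \<otimes> m [^] (i mod p))"
    using m by (simp add: nat_pow_mult)
  also have "\<dots> = a \<otimes> ((m [^] p) [^] (i div p)) \<otimes> m [^] (i mod p)"
    using m a by (simp add: m_assoc nat_pow_pow)
  finally show "a \<otimes> m [^] i = (a \<otimes> ((m [^] p) [^] (i div p))) \<otimes> m [^] (i mod p)" .
  show "a \<otimes> ((m [^] p) [^] (i div p)) \<in> N"
    using a p subgroup_pow_closed[OF N.subgroup_axioms] by (simp add: N.m_closed)
qed

lemma adjoin_alt:
  assumes N: "N \<lhd> G" and m: "m \<in> carrier G" and p: "0 < (p::nat)" "m [^] p \<in> N"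
  shows "adjoin N m = (\<lambda>(a, i). a \<otimes> m [^] i) ` (N \<times> {..<p})"
proof
  show "adjoin N m \<subseteq> (\<lambda>(a, i). a \<otimes> m [^] i) ` (N \<times> {..<p})"
  proof
    fix x assume "x \<in> adjoin N m"
    then obtain a i where x: "x = a \<otimes> m [^] (i::nat)" and "a \<in> N" by (auto simp: adjoin_def)
    then obtain b where "b \<in> N" "x = b \<otimes> m [^] (i mod p)"
      using adjoin_reduce[OF N m p] by metis
    with p show "x \<in> (\<lambda>(a, i). a \<otimes> m [^] i) ` (N \<times> {..<p})" by force
  qed
  show "(\<lambda>(a, i). a \<otimes> m [^] i) ` (N \<times> {..<p}) \<subseteq> adjoin N m"
    by (auto simp: adjoin_def)
qed

lemma coprime_pow_mem:
  assumes H: "subgroup H G" and x: "x \<in> carrier G"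
    and "x [^] (k::nat) \<in> H" "x [^] (l::nat) \<in> H" "coprime k l"
  shows "x \<in> H"
proof (cases "k = 0")
  case True
  then show ?thesis using assms by simp
next
  case False
  then obtain u v where uv: "k * u = l * v + 1"
    using bezout_nat[of k l] assms(5) by auto
  have "x = x [^] (k * u) \<otimes> inv (x [^] (l * v))"
    using x nat_pow_Suc2[OF x, of "l * v"] by (simp add: uv m_assoc del: nat_pow_Suc)
  moreover have "x [^] (k * u) \<in> H" "x [^] (l * v) \<in> H"
    using assms subgroup_pow_closed[OF H] by (simp_all flip: nat_pow_pow)
  ultimately show ?thesis
    using H by (metis subgroup.m_closed subgroup.m_inv_closed)
qed

lemma prime_adjoin_unique:
  assumes N: "N \<lhd> G" and m: "m \<in> carrier G" "m \<notin> N"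
    and p: "Factorial_Ring.prime (p::nat)" "m [^] p \<in> N"
    and ab: "a \<in> N" "b \<in> N" "i < p" "j < p" and eq: "a \<otimes> m [^] i = b \<otimes> m [^] j"
  shows "i = j \<and> a = b"
proof -
  interpret N: normal N G by fact
  have *: "i = j" if "a \<in> N" "b \<in> N" "i < p" "j < p" "a \<otimes> m [^] i = b \<otimes> m [^] j" "i \<le> j"
    for a b i j
  proof (rule ccontr)
    assume "i \<noteq> j"
    with that have j: "j = (j - i) + i" "0 < j - i" "j - i < p" by auto
    have "a \<otimes> m [^] i = b \<otimes> m [^] (j - i) \<otimes> m [^] i"
      using m that j(1) by (metis N.mem_carrier m_assoc nat_pow_closed nat_pow_mult)
    then have "a = b \<otimes> m [^] (j - i)"
      using m that by simp
    then have "m [^] (j - i) = inv b \<otimes> a"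
      using m that by (simp add: inv_solve_left)
    then have "m [^] (j - i) \<in> N" using that by simp
    moreover have "coprime p (j - i)"
      using p(1) j(2,3) by (metis coprime_commute nat_dvd_not_less prime_imp_coprime_nat)
    ultimately have "m \<in> N"
      using coprime_pow_mem[OF N.subgroup_axioms m(1) p(2)] by blast
    with m show False by simp
  qed
  have "i = j"
    using *[OF ab eq] *[OF ab(2,1,4,3) eq[symmetric]] by linarith
  moreover from this have "a = b" using eq ab m by simp
  ultimately show ?thesis by simp
qed

lemma card_adjoin:
  assumes N: "N \<lhd> G" and m: "m \<in> carrier G" "m \<notin> N"
    and p: "Factorial_Ring.prime (p::nat)" "m [^] p \<in> N"
  shows "card (adjoin N m) = p * card N"
proof -
  have "adjoin N m = (\<lambda>(a, i). a \<otimes> m [^] i) ` (N \<times> {..<p})"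
    by (rule adjoin_alt[OF N m(1) _ p(2)]) (simp add: prime_gt_0_nat p(1))
  moreover have "inj_on (\<lambda>(a, i). a \<otimes> m [^] i) (N \<times> {..<p})"
    using prime_adjoin_unique[OF N m p] by (auto simp: inj_on_def)
  ultimately show ?thesis by (simp add: card_image card_cartesian_product)
qed

lemma pow_mult_mem:
  assumes N: "N \<lhd> G" and m: "m \<in> carrier G" and b: "b \<in> N"
  shows "\<exists>b'\<in>N. m [^] (i::nat) \<otimes> b = b' \<otimes> m [^] i"
proof -
  have "m [^] i \<otimes> b = conj_by G (m [^] i) b \<otimes> m [^] i"
    using m b normal_imp_subgroup[OF N] by (simp add: conj_by_mult_self subgroup.mem_carrier)
  with conj_by_normal[OF N _ b] m show ?thesis by blast
qed

lemma adjoin_normal: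
  assumes N: "N \<lhd> G" and m: "m \<in> carrier G" and p: "0 < p" "m [^] (p::nat) \<in> N"
    and central: "\<And>g. g \<in> carrier G \<Longrightarrow> conj_by G g m \<otimes> inv m \<in> N"
  shows "adjoin N m \<lhd> G"
proof (rule normalI_conj_by)
  interpret N: normal N G by fact
  show "subgroup (adjoin N m) G"
  proof (rule subgroupI)
    show "adjoin N m \<subseteq> carrier G" using m by (auto simp: adjoin_def)
    show "adjoin N m \<noteq> {}" using adjoinI[OF N.one_closed] by blast
  next
    fix x y assume "x \<in> adjoin N m" "y \<in> adjoin N m"
    then obtain a i b j where x: "x = a \<otimes> m [^] (i::nat)" "a \<in> N"
      and y: "y = b \<otimes> m [^] (j::nat)" "b \<in> N" by (auto simp: adjoin_def)
    obtain b' where b': "b' \<in> N" "m [^] i \<otimes> b = b' \<otimes> m [^] i"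
      using pow_mult_mem[OF N m y(2)] by blast
    have "x \<otimes> y = a \<otimes> (m [^] i \<otimes> b) \<otimes> m [^] j"
      using x y m by (simp add: m_assoc)
    also have "\<dots> = (a \<otimes> b') \<otimes> m [^] (i + j)"
      using x y m b' by (simp add: m_assoc nat_pow_mult)
    finally show "x \<otimes> y \<in> adjoin N m"
      using x b' by (simp add: adjoinI)
  next
    fix x assume "x \<in> adjoin N m"
    then obtain a i where x: "x = a \<otimes> m [^] (i::nat)" "a \<in> N" "i < p"
      by (auto simp: adjoin_alt[OF N m p])
    have "inv (m [^] i) = inv (m [^] p) \<otimes> m [^] (p - i)"
    proof -
      have "m [^] p = m [^] (p - i) \<otimes> m [^] i" using m x(3) by (simp add: nat_pow_mult)
      then show ?thesis using m by (simp add: inv_mult_group m_assoc)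
    qed
    then have "inv x = inv (m [^] p) \<otimes> (m [^] (p - i) \<otimes> inv a)"
      using m x by (simp add: inv_mult_group m_assoc)
    moreover obtain a' where "a' \<in> N" "m [^] (p - i) \<otimes> inv a = a' \<otimes> m [^] (p - i)"
      using pow_mult_mem[OF N m] x(2) N.m_inv_closed by blast
    ultimately have "inv x = (inv (m [^] p) \<otimes> a') \<otimes> m [^] (p - i)" "inv (m [^] p) \<otimes> a' \<in> N"
      using m p by (simp_all add: m_assoc)
    then show "inv x \<in> adjoin N m" by (simp add: adjoinI)
  qed
next
  interpret N: normal N G by fact
  fix g x assume g: "g \<in> carrier G" and "x \<in> adjoin N m"
  then obtain a i where x: "x = a \<otimes> m [^] (i::nat)" "a \<in> N" by (auto simp: adjoin_def)
  define d where "d = conj_by G g (m [^] i) \<otimes> inv (m [^] i)"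
  have d: "d \<in> N" unfolding d_def by (rule central_mod_pow[OF N g m central[OF g]])
  have "conj_by G g x = conj_by G g a \<otimes> d \<otimes> m [^] i"
    using g x m by (simp add: conj_by_mult d_def m_assoc)
  moreover have "conj_by G g a \<in> N" using conj_by_normal[OF N g x(2)] .
  ultimately show "conj_by G g x \<in> adjoin N m" using d by (simp add: adjoinI)
qed

lemma subset_adjoin: "N \<subseteq> carrier G \<Longrightarrow> N \<subseteq> adjoin N m"
  using adjoinI[of _ N m 0] by (auto simp: subset_iff)

lemma adjoin_subset:
  "subgroup M G \<Longrightarrow> N \<subseteq> M \<Longrightarrow> m \<in> M \<Longrightarrow> adjoin N m \<subseteq> M"
  by (auto simp: adjoin_def intro!: subgroup.m_closed subgroup_pow_closed)

end

section \<open>Nilpotent groups\<close>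

lemma commutator_in_lower_central:
  "h \<in> lower_central G n \<Longrightarrow> g \<in> carrier G \<Longrightarrow>
    h \<otimes>\<^bsub>G\<^esub> g \<otimes>\<^bsub>G\<^esub> inv\<^bsub>G\<^esub> h \<otimes>\<^bsub>G\<^esub> inv\<^bsub>G\<^esub> g \<in> lower_central G (Suc n)"
  by (auto intro!: generate.incl)

context group
begin

text \<open>A relative form of the fact that a nilpotent group has nontrivial center. The witness is any
  element of \<open>M\<close> outside of \<open>N\<close> in the last term of the lower central series that has such elements:
  its commutators with \<open>S\<close> are in the next term.\<close>

lemma nilpotent_central_mod:
  assumes nil: "nilpotent_group G" and N: "subgroup N G" and M: "subgroup M G" and "\<not> M \<subseteq> N"
    and S: "S \<subseteq> carrier G" "\<And>s m. s \<in> S \<Longrightarrow> m \<in> M \<Longrightarrow> conj_by G s m \<in> M"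
  shows "\<exists>m\<in>M - N. \<forall>s\<in>S. conj_by G s m \<otimes> inv m \<in> N"
proof -
  obtain n where n: "lower_central G n = {\<one>}"
    using nil by (auto simp: nilpotent_group_def)
  let ?P = "\<lambda>i. \<not> lower_central G i \<inter> M \<subseteq> N"
  have "?P 0" using assms(4) subgroup.subset[OF M] by auto
  moreover have "\<not> ?P n" using n subgroup.one_closed[OF N] by auto
  ultimately obtain i where i: "?P i" "\<not> ?P (Suc i)"
    using dec_induct[of 0 n ?P] by blast
  then obtain m where m: "m \<in> lower_central G i" "m \<in> M" "m \<notin> N" by auto
  have "conj_by G s m \<otimes> inv m \<in> N" if s: "s \<in> S" for s
  proof -
    have sc: "s \<in> carrier G" and mc: "m \<in> carrier G" using s S M m subgroup.subset by blast+
    have "inv (conj_by G s m \<otimes> inv m) = m \<otimes> s \<otimes> inv m \<otimes> inv s"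
      using sc mc by (simp add: conj_by_def inv_mult_group m_assoc)
    moreover have "m \<otimes> s \<otimes> inv m \<otimes> inv s \<in> lower_central G (Suc i)"
      by (rule commutator_in_lower_central[OF m(1) sc])
    moreover have "inv (conj_by G s m \<otimes> inv m) \<in> M"
      using m(2) S(2)[OF s m(2)] M by (simp add: subgroup.m_closed subgroup.m_inv_closed)
    ultimately have "inv (conj_by G s m \<otimes> inv m) \<in> N" using i(2) by auto
    then show ?thesis
      using subgroup.m_inv_closed[OF N] sc mc by fastforce
  qed
  with m show ?thesis by blast
qed

text \<open>Powers of an element that is central modulo \<open>N\<close> are so too; the witness is a power whose order
  modulo \<open>N\<close> is prime.\<close>

lemma nilpotent_prime_central_mod:
  assumes nil: "nilpotent_group G" and fin: "finite (carrier G)"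
    and N: "N \<lhd> G" and M: "subgroup M G" and "\<not> M \<subseteq> N"
    and S: "S \<subseteq> carrier G" "\<And>s m. s \<in> S \<Longrightarrow> m \<in> M \<Longrightarrow> conj_by G s m \<in> M"
  obtains m p where "m \<in> M" "m \<notin> N" "Factorial_Ring.prime (p::nat)" "m [^] p \<in> N"
    "\<And>s. s \<in> S \<Longrightarrow> conj_by G s m \<otimes> inv m \<in> N"
proof -
  interpret N: normal N G by fact
  obtain m where m: "m \<in> M" "m \<notin> N" "\<And>s. s \<in> S \<Longrightarrow> conj_by G s m \<otimes> inv m \<in> N"
    using nilpotent_central_mod[OF nil N.subgroup_axioms M assms(5) S] by auto
  have mc: "m \<in> carrier G" using m(1) M subgroup.subset by blast
  define n where "n = (LEAST n. 0 < n \<and> m [^] (n::nat) \<in> N)"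
  have ex: "0 < order G \<and> m [^] order G \<in> N"
    using mc fin by (simp add: pow_order_eq_1 order_gt_0_iff_finite)
  have n: "0 < n" "m [^] n \<in> N"
    unfolding n_def using LeastI[of "\<lambda>n. 0 < n \<and> m [^] (n::nat) \<in> N", OF ex] by auto
  have "n \<noteq> 1" using n(2) m(2) mc by auto
  then obtain p where p: "Factorial_Ring.prime p" "p dvd n"
    using prime_factor_nat by blast
  have lt: "n div p < n" "0 < n div p"
    using n p by (auto simp: prime_gt_0_nat div_greater_zero_iff dvd_imp_le prime_gt_Suc_0_nat
        intro!: div_less_dividend)
  let ?m = "m [^] (n div p)"
  show thesis
  proof
    show "?m \<in> M" using subgroup_pow_closed[OF M m(1)] .
    show "?m \<notin> N" using not_less_Least[of "n div p", folded n_def] lt n_def by blast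
    show "?m [^] p \<in> N" using n p mc by (simp add: nat_pow_pow)
    show "conj_by G s ?m \<otimes> inv ?m \<in> N" if "s \<in> S" for s
      using central_mod_pow[OF N _ mc m(3)[OF that]] that S by blast
  qed fact
qed

end



section \<open>Centralizers of abelian normal subgroups\<close>

context group
begin

lemma subgroup_card_dvd:
  assumes "finite (carrier G)" "subgroup H G"
  shows "card H dvd order G"
  using lagrange[OF assms(2)] by (metis dvd_triv_right)

lemma subgroup_card_dvd_subgroup:
  assumes fin: "finite (carrier G)" and "subgroup H G" "subgroup K G" "H \<subseteq> K"
  shows "card H dvd card K"
proof -
  interpret K: group "G\<lparr>carrier := K\<rparr>" using assms by (simp add: subgroup_imp_group)
  have "finite K" using fin assms(3) by (metis finite_subset subgroup.subset)
  moreover have "subgroup H (G\<lparr>carrier := K\<rparr>)"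
    using assms by (simp add: subgroup_incl)
  ultimately show ?thesis
    using K.subgroup_card_dvd by (simp add: order_def)
qed

lemma pow_card_subgroup:
  assumes "finite (carrier G)" "subgroup H G" "x \<in> H"
  shows "x [^] card H = \<one>"
proof -
  interpret H: group "G\<lparr>carrier := H\<rparr>" using assms by (simp add: subgroup_imp_group)
  have "x [^]\<^bsub>G\<lparr>carrier := H\<rparr>\<^esub> order (G\<lparr>carrier := H\<rparr>) = \<one>"
    using H.pow_order_eq_1 assms(3) by simp
  then show ?thesis by (simp add: order_def nat_pow_consistent[symmetric])
qed

lemma subgroup_fixed:
  assumes "g \<in> carrier G"
  shows "subgroup {a \<in> carrier G. conj_by G g a = a} G"
  using assms by (intro subgroupI) (auto simp: conj_by_mult conj_by_inv intro: exI[of _ \<one>])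

lemma subgroup_stabilizer:
  assumes "A \<subseteq> carrier G"
  shows "subgroup {g \<in> carrier G. \<forall>a\<in>A. conj_by G g a = a} G"
proof (rule subgroupI)
  fix g assume g: "g \<in> {g \<in> carrier G. \<forall>a\<in>A. conj_by G g a = a}"
  then have "conj_by G (inv g) a = a" if "a \<in> A" for a
    using assms that conj_by_inv_conj_by[of g a] by auto
  with g show "inv g \<in> {g \<in> carrier G. \<forall>a\<in>A. conj_by G g a = a}" by simp
qed (use assms in \<open>auto simp: conj_by_conj_by[symmetric] subset_iff intro: exI[of _ \<one>]\<close>)

text \<open>Descend along the lower central series: the commutator \<open>d\<close> of \<open>x\<close> and \<open>b\<close> is one step further, so
  that \<open>x\<close> commutes with \<open>d\<close> by induction. Then the conjugate of \<open>b\<close> by \<open>x\<^sup>k = 1\<close> is \<open>d\<^sup>k b\<close>, and the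
  order of \<open>d\<close> divides both \<open>k\<close> and \<open>t\<close>.\<close>

lemma nilpotent_coprime_commute:
  assumes nil: "nilpotent_group G" and A: "A \<lhd> G"
    and comm: "\<And>a b. a \<in> A \<Longrightarrow> b \<in> A \<Longrightarrow> a \<otimes> b = b \<otimes> a"
    and x: "x \<in> carrier G" "x [^] (k::nat) = \<one>"
    and b: "b \<in> A" "b [^] (t::nat) = \<one>" and "coprime k t"
  shows "conj_by G x b = b"
proof -
  interpret A: normal A G by fact
  obtain n where n: "lower_central G n = {\<one>}"
    using nil by (auto simp: nilpotent_group_def)
  let ?P = "\<lambda>i. \<forall>b \<in> A \<inter> lower_central G i. b [^] t = \<one> \<longrightarrow> conj_by G x b = b"
  have "?P i" if "?P (Suc i)" for i
  proof (intro ballI impI)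
    fix b assume b: "b \<in> A \<inter> lower_central G i" "b [^] t = \<one>"
    then have bc: "b \<in> carrier G" by auto
    define d where "d = conj_by G x b \<otimes> inv b"
    have conjA: "conj_by G x b \<in> A" using conj_by_normal[OF A x(1)] b by blast
    then have dA: "d \<in> A" using b by (simp add: d_def)
    then have dc: "d \<in> carrier G" by simp
    have dt: "d [^] t = \<one>"
    proof -
      have "d [^] t = conj_by G x b [^] t \<otimes> inv b [^] t"
        unfolding d_def using conjA b comm by (intro pow_mult_distrib) auto
      also have "\<dots> = conj_by G x (b [^] t) \<otimes> inv (b [^] t)"
        using x bc by (simp add: conj_by_pow nat_pow_inv)
      finally show ?thesis using b x by simp
    qed
    have "inv d = b \<otimes> x \<otimes> inv b \<otimes> inv x"
      using x bc by (simp add: d_def conj_by_def inv_mult_group m_assoc)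
    then have "inv d \<in> lower_central G (Suc i)"
      using commutator_in_lower_central[of b G i x] b x by simp
    moreover have "inv d [^] t = \<one>" using dt dc by (simp add: nat_pow_inv)
    ultimately have "conj_by G x (inv d) = inv d" using that dA by simp
    then have xd: "conj_by G x d = d" using x dc by (metis conj_by_inv inv_inv inv_closed)
    have "conj_by G (x [^] j) b = d [^] j \<otimes> b" for j :: nat
    proof (induction j)
      case (Suc j)
      have "conj_by G (x [^] Suc j) b = conj_by G x (conj_by G (x [^] j) b)"
        using x bc nat_pow_Suc2[OF x(1), of j] by (simp add: conj_by_conj_by)
      also have "\<dots> = d [^] j \<otimes> conj_by G x b"
        using x bc dc Suc xd by (simp add: conj_by_mult conj_by_pow)
      also have "conj_by G x b = d \<otimes> b" using x bc by (simp add: d_def m_assoc)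
      finally show ?case using dc bc by (simp add: m_assoc)
    qed (use bc in simp)
    from this[of k] have "d [^] k = \<one>" using x bc dc by simp
    then have "d \<in> {\<one>}"
      using coprime_pow_mem[of "{\<one>}" d k t] dt dc assms(8) by (simp add: triv_subgroup)
    then show "conj_by G x b = b"
      using x bc by (simp add: d_def inv_solve_right')
  qed
  moreover have "?P n" using n x by simp
  ultimately have "?P 0" by (induction n) blast+
  then show ?thesis using b A.subset by auto
qed

text \<open>A chain of normal subgroups of \<open>G\<close> in \<open>T\<close> whose orders are \<open>1, p, p\<^sup>2, \<dots>\<close> and whose factors are
  central ends after two steps. So an action of an element of \<open>G\<close> on \<open>T\<close> is determined by the
  image of a single \<open>a\<close>, for which there are at most \<open>p\<close> possibilities.\<close>

lemma p_part_structure: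
  assumes nil: "nilpotent_group G" and fin: "finite (carrier G)"
    and T: "T \<lhd> G" and p: "Factorial_Ring.prime (p::nat)"
    and tors: "\<And>a. a \<in> T \<Longrightarrow> \<exists>j. a [^] (p ^ j) = \<one>"
    and small: "\<not> p ^ 3 dvd card T"
  obtains N a where "N \<lhd> G" "card N \<le> p" "\<And>g n. g \<in> carrier G \<Longrightarrow> n \<in> N \<Longrightarrow> conj_by G g n = n"
    "a \<in> T" "\<And>g. g \<in> carrier G \<Longrightarrow> conj_by G g a \<otimes> inv a \<in> N" "T \<subseteq> adjoin N a"
proof -
  interpret T: normal T G by fact
  have ext: "\<exists>m\<in>T. adjoin N m \<lhd> G \<and> adjoin N m \<subseteq> T \<and> card (adjoin N m) = p * card N \<and>
      (\<forall>g\<in>carrier G. conj_by G g m \<otimes> inv m \<in> N)"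
    if N: "N \<lhd> G" "N \<subseteq> T" "\<not> T \<subseteq> N" for N
  proof -
    obtain m q where m: "m \<in> T" "m \<notin> N" "Factorial_Ring.prime (q::nat)" "m [^] q \<in> N"
      "\<And>s. s \<in> carrier G \<Longrightarrow> conj_by G s m \<otimes> inv m \<in> N"
      using nilpotent_prime_central_mod[OF nil fin N(1) T.subgroup_axioms N(3) order_refl]
        conj_by_normal[OF T] by metis
    have mc: "m \<in> carrier G" using m(1) by simp
    have Ns: "subgroup N G" using N(1) by (rule normal_imp_subgroup)
    obtain j where j: "m [^] (p ^ j) = \<one>" using tors[OF m(1)] by blast
    have "q = p"
    proof (rule ccontr)
      assume "q \<noteq> p"
      then have "coprime q (p ^ j)" using m(3) p by (simp add: primes_coprime)
      then show False
        using coprime_pow_mem[OF Ns mc m(4)] j m(2) subgroup.one_closed[OF Ns] by metis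
    qed
    then have "card (adjoin N m) = p * card N" "adjoin N m \<lhd> G"
      using card_adjoin[OF N(1) mc m(2,3,4)] adjoin_normal[OF N(1) mc _ m(4)] m(5) prime_gt_0_nat[OF p]
      by auto
    moreover have "adjoin N m \<subseteq> T" using adjoin_subset[OF T.subgroup_axioms N(2) m(1)] .
    ultimately show ?thesis using m by blast
  qed
  have one: "{\<one>} \<lhd> G" by (rule one_is_normal)
  show thesis
  proof (cases "T \<subseteq> {\<one>}")
    case True
    then have "T \<subseteq> adjoin {\<one>} \<one>" using subset_adjoin[of "{\<one>}" \<one>] by auto
    then show ?thesis using that[OF one, of \<one>] prime_gt_0_nat[OF p] by simp
  next
    case False
    then obtain z where z: "z \<in> T" "adjoin {\<one>} z \<lhd> G" "adjoin {\<one>} z \<subseteq> T"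
      "card (adjoin {\<one>} z) = p" "\<And>g. g \<in> carrier G \<Longrightarrow> conj_by G g z \<otimes> inv z = \<one>"
      using ext[OF one] by force
    have zc: "z \<in> carrier G" using z(1) by simp
    have zfix: "conj_by G g z = z" if "g \<in> carrier G" for g
      using z(5)[OF that] zc that by (simp add: inv_solve_right')
    let ?N = "adjoin {\<one>} z"
    have Nfix: "conj_by G g n = n" if "g \<in> carrier G" "n \<in> ?N" for g n
      using that zc zfix[OF that(1)] by (auto simp: adjoin_def conj_by_mult conj_by_pow)
    show ?thesis
    proof (cases "T \<subseteq> ?N")
      case True
      with z show ?thesis using that[OF one, of z] prime_gt_0_nat[OF p] by simp
    next
      case False
      then obtain a where a: "a \<in> T" "adjoin ?N a \<lhd> G" "adjoin ?N a \<subseteq> T"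
        "card (adjoin ?N a) = p * p" "\<And>g. g \<in> carrier G \<Longrightarrow> conj_by G g a \<otimes> inv a \<in> ?N"
        using ext[OF z(2,3)] z(4) by force
      have "T \<subseteq> adjoin ?N a"
      proof (rule ccontr)
        assume "\<not> T \<subseteq> adjoin ?N a"
        then obtain b where "adjoin (adjoin ?N a) b \<lhd> G" "adjoin (adjoin ?N a) b \<subseteq> T"
          "card (adjoin (adjoin ?N a) b) = p ^ 3"
          using ext[OF a(2,3)] a(4) by (force simp: power3_eq_cube)
        then show False
          using subgroup_card_dvd_subgroup[OF fin normal_imp_subgroup T.subgroup_axioms] small
          by metis
      qed
      then show ?thesis using that[OF z(2) _ Nfix a(1,5)] z(4) by simp
    qed
  qed
qed

text \<open>Equivalently, \<open>p\<^sup>2\<close> does not divide the index of the centralizer of \<open>A\<close>. An element of a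
  \<open>p\<close>-subgroup \<open>P\<close> commutes with the elements of \<open>A\<close> of order prime to \<open>p\<close>, so that only the
  \<open>p\<close>-part \<open>T\<close> of \<open>A\<close> matters, and \<open>P\<close> acts on \<open>T\<close> through at most \<open>p\<close> automorphisms.\<close>

lemma centralizer_p_part:
  assumes nil: "nilpotent_group G" and fin: "finite (carrier G)" and A: "A \<lhd> G"
    and comm: "\<And>a b. a \<in> A \<Longrightarrow> b \<in> A \<Longrightarrow> a \<otimes> b = b \<otimes> a"
    and p: "Factorial_Ring.prime (p::nat)" "\<not> p ^ 3 dvd card A" and n: "p ^ Suc n dvd order G"
  shows "p ^ n dvd card {g \<in> carrier G. \<forall>a\<in>A. conj_by G g a = a}"
proof -
  interpret A: normal A G by fact
  let ?C = "{g \<in> carrier G. \<forall>a\<in>A. conj_by G g a = a}"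
  have C: "subgroup ?C G" by (rule subgroup_stabilizer) (rule A.subset)
  obtain P where P: "subgroup P G" "card P = p ^ Suc n"
    using sylow_thm[OF p(1) is_group, of "Suc n" "order G div p ^ Suc n"] n fin by auto
  then interpret P: subgroup P G by simp
  have finP: "finite P" using fin P.subset finite_subset by blast
  define T where "T = {a \<in> A. \<exists>j. a [^] (p ^ j) = \<one>}"
  have T: "T \<lhd> G"
  proof (rule normalI_conj_by)
    show "subgroup T G"
    proof (rule subgroupI)
      show "T \<subseteq> carrier G" by (auto simp: T_def)
      have "\<one> \<in> T" by (auto simp: T_def)
      then show "T \<noteq> {}" by blast
    next
      fix a assume "a \<in> T" then show "inv a \<in> T" by (auto simp: T_def nat_pow_inv)
    next
      fix a b assume "a \<in> T" "b \<in> T"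
      then obtain i j where ab: "a \<in> A" "b \<in> A" "a [^] (p ^ i) = \<one>" "b [^] (p ^ j) = \<one>"
        by (auto simp: T_def)
      have "(a \<otimes> b) [^] (p ^ (i + j)) = a [^] (p ^ i * p ^ j) \<otimes> b [^] (p ^ j * p ^ i)"
        using pow_mult_distrib[OF comm[OF ab(1,2)], of "p ^ (i + j)"] ab
        by (metis A.mem_carrier add.commute power_add)
      moreover have "a [^] (p ^ i * p ^ j) = \<one>"
        using nat_pow_pow[of a "p ^ i" "p ^ j"] ab(1,3) by simp
      moreover have "b [^] (p ^ j * p ^ i) = \<one>"
        using nat_pow_pow[of b "p ^ j" "p ^ i"] ab(2,4) by simp
      ultimately have "(a \<otimes> b) [^] (p ^ (i + j)) = \<one>" by simp
      with ab show "a \<otimes> b \<in> T" by (auto simp: T_def)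
    qed
    show "conj_by G g a \<in> T" if g: "g \<in> carrier G" and a: "a \<in> T" for g a
    proof -
      obtain j where j: "a \<in> A" "a [^] (p ^ j) = \<one>" using a by (auto simp: T_def)
      then have "conj_by G g a [^] (p ^ j) = \<one>"
        using g A.mem_carrier by (simp flip: conj_by_pow)
      then show ?thesis using conj_by_normal[OF A g j(1)] by (auto simp: T_def)
    qed
  qed
  have TA: "T \<subseteq> A" by (auto simp: T_def)
  have "card T dvd card A"
    using subgroup_card_dvd_subgroup[OF fin normal_imp_subgroup[OF T] A.subgroup_axioms TA] .
  then have smallT: "\<not> p ^ 3 dvd card T" using p(2) dvd_trans by blast
  obtain N a where N: "N \<lhd> G" "card N \<le> p" "\<And>g n. g \<in> carrier G \<Longrightarrow> n \<in> N \<Longrightarrow> conj_by G g n = n"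
    and a: "a \<in> T" "\<And>g. g \<in> carrier G \<Longrightarrow> conj_by G g a \<otimes> inv a \<in> N" "T \<subseteq> adjoin N a"
    using p_part_structure[OF nil fin T p(1) _ smallT] by (auto simp: T_def)
  have ac: "a \<in> carrier G" using a(1) TA by auto
  have Nc: "N \<subseteq> carrier G" using N(1) normal_imp_subgroup subgroup.subset by blast
  define Q where "Q = {x \<in> P. conj_by G x a = a}"
  have "Q \<subseteq> ?C"
  proof
    fix x assume x: "x \<in> Q"
    then have xc: "x \<in> carrier G" by (auto simp: Q_def)
    have fixT: "conj_by G x b = b" if "b \<in> T" for b
      using subsetD[OF a(3) that] x xc ac Nc N(3)[OF xc]
      by (auto simp: adjoin_def Q_def conj_by_mult conj_by_pow subset_iff)
    have "conj_by G x b = b" if b: "b \<in> A" for b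
    proof -
      define t where "t = card A div p ^ multiplicity p (card A)"
      have cA: "card A \<noteq> 0" using fin A.subset A.one_closed finite_subset by (metis card_0_eq empty_iff)
      have t: "card A = p ^ multiplicity p (card A) * t"
        unfolding t_def by (simp add: multiplicity_dvd)
      have nd: "\<not> p dvd t"
        unfolding t_def using cA p(1) by (intro multiplicity_decompose) auto
      have bA: "b [^] card A = \<one>" using pow_card_subgroup[OF fin A.subgroup_axioms b] .
      have bt: "(b [^] t) [^] (p ^ multiplicity p (card A)) = \<one>"
        "(b [^] (p ^ multiplicity p (card A))) [^] t = \<one>"
        using b bA t by (simp_all add: nat_pow_pow mult.commute)
      have "b [^] t \<in> T"
        using bt(1) subgroup_pow_closed[OF A.subgroup_axioms b] by (auto simp: T_def)
      then have 1: "conj_by G x (b [^] t) = b [^] t" by (rule fixT)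
      have "x [^] (p ^ Suc n) = \<one>"
        using pow_card_subgroup[OF fin P(1)] x P(2) by (simp add: Q_def)
      moreover have cop: "coprime p t" using nd p(1) by (simp add: prime_imp_coprime_nat)
      moreover have "b [^] (p ^ multiplicity p (card A)) \<in> A"
        using subgroup_pow_closed[OF A.subgroup_axioms b] .
      ultimately have 2: "conj_by G x (b [^] (p ^ multiplicity p (card A))) =
          b [^] (p ^ multiplicity p (card A))"
        using nilpotent_coprime_commute[OF nil A comm xc _ _ bt(2)] by simp
      have "b \<in> {b \<in> carrier G. conj_by G x b = b}"
        using 1 2 b cop by (intro coprime_pow_mem[OF subgroup_fixed[OF xc], of b t "p ^ multiplicity p (card A)"])
          (auto simp: coprime_commute)
      then show ?thesis by simp
    qed
    with xc show "x \<in> ?C" by simp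
  qed
  moreover have Qs: "subgroup Q G"
  proof -
    have "Q = P \<inter> {g \<in> carrier G. \<forall>b\<in>{a}. conj_by G g b = b}" by (auto simp: Q_def)
    then show ?thesis
      using subgroups_Inter_pair[OF P(1) subgroup_stabilizer[of "{a}"]] ac by simp
  qed
  ultimately have QC: "card Q dvd card ?C"
    by (intro subgroup_card_dvd_subgroup[OF fin Qs C])
  have finQ: "finite Q" using finP by (auto simp: Q_def)
  \<comment> \<open>the fibres of \<open>x \<mapsto> [x, a]\<close> are cosets of \<open>Q\<close>\<close>
  have "card P \<le> card Q * p"
  proof -
    let ?F = "\<lambda>d. {x \<in> P. conj_by G x a \<otimes> inv a = d}"
    have "P = (\<Union>d\<in>N. ?F d)" using a(2) by auto
    moreover have "finite N" using fin Nc finite_subset by blast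
    ultimately have "card P \<le> (\<Sum>d\<in>N. card (?F d))" using card_UN_le by metis
    also have "\<dots> \<le> of_nat (card N) * card Q"
    proof (rule sum_bounded_above)
      fix d
      show "card (?F d) \<le> card Q"
      proof (cases "?F d = {}")
        case True
        then show ?thesis by (metis card.empty le0)
      next
        case False
        then obtain x where x: "x \<in> P" "conj_by G x a \<otimes> inv a = d" by auto
        have "(\<lambda>y. inv x \<otimes> y) ` ?F d \<subseteq> Q"
        proof
          fix w assume "w \<in> (\<lambda>y. inv x \<otimes> y) ` ?F d"
          then obtain y where y: "y \<in> P" "conj_by G y a \<otimes> inv a = d" "w = inv x \<otimes> y" by auto
          have "conj_by G y a = conj_by G x a" using x y ac by (metis P.mem_carrier conj_by_closed inv_closed right_cancel)
          then have "conj_by G w a = a"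
            using x(1) y(1,3) ac by (simp flip: conj_by_conj_by)
          then show "w \<in> Q" using x y by (simp add: Q_def)
        qed
        moreover have "inj_on (\<lambda>y. inv x \<otimes> y) (?F d)"
          using x(1) by (auto simp: inj_on_def)
        ultimately show ?thesis using finQ card_inj_on_le by blast
      qed
    qed
    also have "\<dots> \<le> card Q * p" using N(2) by simp
    finally show ?thesis .
  qed
  moreover obtain w where w: "card Q = p ^ w"
  proof -
    have "card Q dvd p ^ Suc n"
      using subgroup_card_dvd_subgroup[OF fin Qs P(1)] P(2) by (auto simp: Q_def)
    then show ?thesis using that p(1) divides_primepow_nat by blast
  qed
  ultimately have "p ^ Suc n \<le> p ^ Suc w" using P(2) by simp
  then have "n \<le> w" using p(1) prime_gt_0_nat prime_gt_Suc_0_nat by auto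
  then have "p ^ n dvd card Q" using w by (simp add: le_imp_power_dvd)
  with QC show ?thesis using dvd_trans by blast
qed

text \<open>The number \<open>|N||H| / |N \<inter> H|\<close> is the order of the subgroup \<open>NH\<close>.\<close>

lemma card_mult_card_dvd:
  assumes fin: "finite (carrier G)" and N: "N \<lhd> G" and H: "subgroup H G"
  shows "card N * card H dvd order G * card (N \<inter> H)"
proof -
  interpret N: normal N G by fact
  interpret H: group "G\<lparr>carrier := H\<rparr>" using H by (rule subgroup_imp_group)
  interpret Q: group "G Mod N" by (rule N.factorgroup_is_group)
  let ?f = "\<lambda>x. N #> x"
  interpret f: group_hom "G\<lparr>carrier := H\<rparr>" "G Mod N" ?f
    by unfold_locales (use N.r_coset_hom_Mod H in \<open>auto simp: hom_def subgroup.mem_carrier\<close>)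
  have Hc: "H \<subseteq> carrier G" using H by (rule subgroup.subset)
  have ker: "kernel (G\<lparr>carrier := H\<rparr>) (G Mod N) ?f = N \<inter> H"
  proof -
    have "N #> x = N \<longleftrightarrow> x \<in> N" if "x \<in> H" for x
      using that Hc N.subgroup_axioms by (metis coset_join1 coset_join2 N.subset subsetD)
    then show ?thesis by (auto simp: kernel_def)
  qed
  have 1: "card (rcosets\<^bsub>G\<lparr>carrier := H\<rparr>\<^esub> (N \<inter> H)) * card (N \<inter> H) = card H"
    using H.lagrange[OF f.subgroup_kernel] by (simp add: ker order_def)
  have 2: "card (rcosets\<^bsub>G\<lparr>carrier := H\<rparr>\<^esub> (N \<inter> H)) = card (?f ` H)"
  proof -
    have imH: "subgroup (?f ` H) (G Mod N)" using f.img_is_subgroup by simp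
    interpret I: group "(G Mod N)\<lparr>carrier := ?f ` H\<rparr>" using imH by (rule Q.subgroup_imp_group)
    interpret i: group_hom "G\<lparr>carrier := H\<rparr>" "(G Mod N)\<lparr>carrier := ?f ` H\<rparr>" ?f
      by unfold_locales (use f.homh in \<open>auto simp: hom_def\<close>)
    have "kernel (G\<lparr>carrier := H\<rparr>) ((G Mod N)\<lparr>carrier := ?f ` H\<rparr>) ?f = N \<inter> H"
      using ker by (simp add: kernel_def)
    then show ?thesis
      using i.FactGroup_iso_set by (auto simp: iso_def FactGroup_def dest: bij_betw_same_card)
  qed
  have "card (?f ` H) dvd order (G Mod N)"
    using Q.subgroup_card_dvd f.img_is_subgroup fin by (simp add: FactGroup_def RCOSETS_def)
  then obtain s where 3: "order (G Mod N) = card (?f ` H) * s" by (rule dvdE)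
  have 4: "order (G Mod N) * card N = order G"
    using lagrange[OF N.subgroup_axioms] by (simp add: order_def FactGroup_def)
  have "order G * card (N \<inter> H) = (card N * card H) * s"
    unfolding 4[symmetric] 1[symmetric] 2 3 by (simp add: mult_ac)
  then show ?thesis by simp
qed

end


section \<open>The twisted conjugation action\<close>

locale finite_group_cocycle = group +
  fixes c :: "'a \<times> 'a \<Rightarrow> complex"
  assumes fin: "finite (carrier G)"
    and cocycle: "c \<in> two_cocycles G"
begin

text \<open>The factor by which \<open>u\<^sub>g u\<^sub>x u\<^sub>g\<^sup>-\<^sup>1\<close> differs from the basis element at \<open>g x g\<^sup>-\<^sup>1\<close>. The next lemmas
  express that conjugation is an action by algebra automorphisms.\<close>

definition twist :: "'a \<Rightarrow> 'a \<Rightarrow> complex" where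
  "twist g x = c (g, x) / c (conj_by G g x, g)"

lemma c_nonzero [simp]: "g \<in> carrier G \<Longrightarrow> h \<in> carrier G \<Longrightarrow> c (g, h) \<noteq> 0"
  by (rule two_cocycles_nonzero[OF cocycle])

lemma cocycle_eq:
  "g \<in> carrier G \<Longrightarrow> h \<in> carrier G \<Longrightarrow> k \<in> carrier G \<Longrightarrow>
    c (g, h) * c (g \<otimes> h, k) = c (g, h \<otimes> k) * c (h, k)"
  using cocycle by (simp add: two_cocycles_def)

lemma twist_nonzero [simp]: "g \<in> carrier G \<Longrightarrow> x \<in> carrier G \<Longrightarrow> twist g x \<noteq> 0"
  by (simp add: twist_def)

lemma twist_commuting:
  "g \<in> carrier G \<Longrightarrow> x \<in> carrier G \<Longrightarrow> conj_by G g x = x \<Longrightarrow> twist g x = c (g, x) / c (x, g)"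
  by (simp add: twist_def)

lemma twist_mult_left:
  assumes g: "g \<in> carrier G" and h: "h \<in> carrier G" and x: "x \<in> carrier G"
  shows "twist (g \<otimes> h) x = twist h x * twist g (conj_by G h x)"
proof -
  define y where "y = conj_by G h x"
  define z where "z = conj_by G g y"
  have yc: "y \<in> carrier G" and zc: "z \<in> carrier G" using assms by (simp_all add: y_def z_def)
  have yh: "y \<otimes> h = h \<otimes> x" and zg: "z \<otimes> g = g \<otimes> y"
    unfolding y_def z_def using assms by (simp_all add: conj_by_mult_self)
  have z': "conj_by G (g \<otimes> h) x = z" using assms by (simp add: z_def y_def conj_by_conj_by)
  have 1: "c (g, h) * c (g \<otimes> h, x) = c (g, h \<otimes> x) * c (h, x)" using assms by (rule cocycle_eq)
  have 2: "c (g, y) * c (g \<otimes> y, h) = c (g, h \<otimes> x) * c (y, h)"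
    using cocycle_eq[OF g yc h] yh by simp
  have 3: "c (z, g) * c (g \<otimes> y, h) = c (z, g \<otimes> h) * c (g, h)"
    using cocycle_eq[OF zc g h] zg by simp
  have "c (g, h) * c (g \<otimes> y, h) * (c (g \<otimes> h, x) * (c (y, h) * c (z, g))) =
      (c (g, h) * c (g \<otimes> h, x)) * c (y, h) * (c (z, g) * c (g \<otimes> y, h))"
    by (simp only: mult_ac)
  also have "\<dots> = (c (g, h \<otimes> x) * c (y, h)) * (c (g, h) * (c (h, x) * c (z, g \<otimes> h)))"
    unfolding 1 3 by (simp only: mult_ac)
  also have "\<dots> = c (g, h) * c (g \<otimes> y, h) * (c (h, x) * c (g, y) * c (z, g \<otimes> h))"
    unfolding 2[symmetric] by (simp only: mult_ac)
  finally have "c (g \<otimes> h, x) * (c (y, h) * c (z, g)) = c (h, x) * c (g, y) * c (z, g \<otimes> h)"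
    using assms yc by (simp only: mult_left_cancel mult_eq_0_iff c_nonzero m_closed simp_thms)
  then have "c (g \<otimes> h, x) / c (z, g \<otimes> h) = c (h, x) * c (g, y) / (c (y, h) * c (z, g))"
    using assms yc zc by (simp only: frac_eq_eq mult_eq_0_iff c_nonzero m_closed simp_thms)
  then show ?thesis
    unfolding twist_def z' y_def[symmetric] z_def[symmetric] by simp
qed

lemma twist_mult_right:
  assumes g: "g \<in> carrier G" and x: "x \<in> carrier G" and y: "y \<in> carrier G"
  shows "twist g (x \<otimes> y) * c (x, y) = twist g x * twist g y * c (conj_by G g x, conj_by G g y)"
proof -
  define x' where "x' = conj_by G g x"
  define y' where "y' = conj_by G g y"
  have xc: "x' \<in> carrier G" and yc: "y' \<in> carrier G" using assms by (simp_all add: x'_def y'_def)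
  have xg: "x' \<otimes> g = g \<otimes> x" and yg: "y' \<otimes> g = g \<otimes> y"
    unfolding x'_def y'_def using assms by (simp_all add: conj_by_mult_self)
  have xy: "conj_by G g (x \<otimes> y) = x' \<otimes> y'" using assms by (simp add: x'_def y'_def conj_by_mult)
  have 1: "c (g, x) * c (g \<otimes> x, y) = c (g, x \<otimes> y) * c (x, y)" using assms by (rule cocycle_eq)
  have 2: "c (x', g) * c (g \<otimes> x, y) = c (x', g \<otimes> y) * c (g, y)"
    using cocycle_eq[OF xc g y] xg by simp
  have 3: "c (x', y') * c (x' \<otimes> y', g) = c (x', g \<otimes> y) * c (y', g)"
    using cocycle_eq[OF xc yc g] yg by simp
  have "c (g, x \<otimes> y) * c (x, y) * (c (x', g) * c (y', g)) =
      c (g, x) * (c (x', g) * c (g \<otimes> x, y)) * c (y', g)"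
    unfolding 1[symmetric] by (simp only: mult_ac)
  also have "\<dots> = c (g, x) * c (g, y) * (c (x', g \<otimes> y) * c (y', g))"
    unfolding 2 by (simp only: mult_ac)
  also have "\<dots> = c (g, x) * c (g, y) * c (x', y') * c (x' \<otimes> y', g)"
    unfolding 3[symmetric] by (simp only: mult_ac)
  finally have "c (g, x \<otimes> y) * c (x, y) * (c (x', g) * c (y', g)) =
      c (g, x) * c (g, y) * c (x', y') * c (x' \<otimes> y', g)" .
  then have "c (g, x \<otimes> y) * c (x, y) / c (x' \<otimes> y', g) =
      c (g, x) * c (g, y) * c (x', y') / (c (x', g) * c (y', g))"
    using assms xc yc by (simp only: frac_eq_eq mult_eq_0_iff c_nonzero m_closed simp_thms)
  then show ?thesis
    unfolding twist_def xy x'_def[symmetric] y'_def[symmetric] by simp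
qed

text \<open>The left-hand side is the coefficient at \<open>y\<close> of the sum over \<open>g\<close> of all \<open>u\<^sub>g z u\<^sub>g\<^sup>-\<^sup>1\<close>, where
  \<open>z = \<Sum>x. \<phi>(x) u\<^sub>x\<close>. This sum is invariant under conjugation, so its coefficient at \<open>y\<close> is
  multiplied by \<open>twist h y\<close>, and yet unchanged, for every \<open>h\<close> that commutes with \<open>y\<close>. For a
  nondegenerate cocycle one of these factors is not 1.\<close>

lemma twisted_class_sum:
  assumes nd: "nondegenerate_cocycle G c" and y: "y \<in> carrier G" "y \<noteq> \<one>"
  shows "(\<Sum>g\<in>carrier G. \<phi> (conj_by G (inv g) y) * twist g (conj_by G (inv g) y)) = 0"
    (is "sum ?f _ = 0")
proof -
  obtain h where h: "h \<in> carrier G" "h \<otimes> y = y \<otimes> h" "c (y, h) \<noteq> c (h, y)"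
    using nd y by (auto simp: nondegenerate_cocycle_def centralizer_def)
  have hy: "conj_by G h y = y" using h y by (simp add: conj_by_eq_self_iff)
  have hy': "conj_by G (inv h) y = y" using conj_by_inv_conj_by[OF h(1) y(1)] hy by simp
  have t: "twist h y \<noteq> 1" using h y hy by (simp add: twist_commuting)
  have "?f (h \<otimes> g) = twist h y * ?f g" if g: "g \<in> carrier G" for g
  proof -
    have "conj_by G (inv (h \<otimes> g)) y = conj_by G (inv g) y"
      using g h(1) y(1) hy' conj_by_conj_by[of "inv g" "inv h" y] by (simp add: inv_mult_group)
    then show ?thesis
      using g h(1) y(1) by (simp add: twist_mult_left)
  qed
  then have "(\<Sum>g\<in>carrier G. ?f (h \<otimes> g)) = (\<Sum>g\<in>carrier G. twist h y * ?f g)"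
    by (intro sum.cong refl)
  also have "\<dots> = twist h y * sum ?f (carrier G)" by (rule sum_distrib_left[symmetric])
  finally have "twist h y * sum ?f (carrier G) = (\<Sum>g\<in>carrier G. ?f (h \<otimes> g))" by (rule sym)
  also have "\<dots> = sum ?f (carrier G)"
    by (rule sum.reindex_bij_witness[of _ "\<lambda>g. inv h \<otimes> g" "\<lambda>g. h \<otimes> g"]) (use h(1) in simp_all)
  finally show ?thesis using t unfolding mult_cancel_right2 by blast
qed

end

lemma (in group) sum_character:
  fixes \<theta> :: "'a \<Rightarrow> complex"
  assumes A: "subgroup A G" and \<theta>: "\<And>a b. a \<in> A \<Longrightarrow> b \<in> A \<Longrightarrow> \<theta> (a \<otimes> b) = \<theta> a * \<theta> b"
  shows "sum \<theta> A = (if \<forall>a\<in>A. \<theta> a = 1 then of_nat (card A) else 0)"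
proof (cases "\<forall>a\<in>A. \<theta> a = 1")
  case False
  then obtain b where b: "b \<in> A" "\<theta> b \<noteq> 1" by auto
  interpret A: subgroup A G by fact
  have "sum \<theta> A = (\<Sum>a\<in>A. \<theta> (b \<otimes> a))"
    by (rule sum.reindex_bij_witness[of _ "\<lambda>a. b \<otimes> a" "\<lambda>a. inv b \<otimes> a"]) (use b in simp_all)
  also have "\<dots> = \<theta> b * sum \<theta> A" using b \<theta> by (simp add: sum_distrib_left)
  finally have "sum \<theta> A = 0" using b(2) unfolding mult_cancel_right1 by blast
  then show ?thesis by (simp only: False if_False)
qed simp

lemma complex_root_exists:
  assumes "0 < n" shows "\<exists>w. w ^ n = (z::complex)"
proof
  show "rcis (root n (cmod z)) (Arg z / real n) ^ n = z"
    using assms by (simp add: DeMoivre2 rcis_cmod_Arg)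
qed

section \<open>Normal isotropic subgroups\<close>

locale normalized_cocycle = finite_group_cocycle + normal A G for A +
  assumes normalized: "\<And>a x. a \<in> A \<Longrightarrow> x \<in> carrier G \<Longrightarrow> c (a, x) = 1"
    and nondeg: "nondegenerate_cocycle G c"
begin

lemma normal_A: "A \<lhd> G" by (rule normal_axioms)

lemma conj_by_A: "g \<in> carrier G \<Longrightarrow> a \<in> A \<Longrightarrow> conj_by G g a \<in> A"
  by (rule conj_by_normal[OF normal_A])

lemma finite_A: "finite A" using fin subset finite_subset by blast

lemma card_A_pos: "card A > 0" using finite_A one_closed unfolding card_gt_0_iff by blast

lemma twist_char:
  assumes "g \<in> carrier G" "a \<in> A" "x \<in> carrier G"
  shows "twist g (a \<otimes> x) = twist g a * twist g x"
  using twist_mult_right[of g a x] assms normalized conj_by_A by simp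

lemma twist_one: "g \<in> carrier G \<Longrightarrow> twist g \<one> = 1"
  using twist_char[of g \<one> \<one>] twist_nonzero[of g \<one>] by simp

lemma twist_A: "a \<in> A \<Longrightarrow> b \<in> A \<Longrightarrow> twist a b = 1"
  using normalized conj_by_A by (simp add: twist_def)

text \<open>With \<open>z = \<Sum>a\<in>A. u\<^sub>a\<close>, the element \<open>u\<^sub>g z u\<^sub>g\<^sup>-\<^sup>1\<close> is \<open>\<Sum>a\<in>A. orbit_char g a u\<^sub>a\<close>. So this is the point to
  which \<open>g\<close> moves the trivial character of \<open>A\<close>.\<close>

definition orbit_char :: "'a \<Rightarrow> 'a \<Rightarrow> complex" where
  "orbit_char g a = twist g (conj_by G (inv g) a)"

lemma orbit_char_nonzero: "g \<in> carrier G \<Longrightarrow> a \<in> A \<Longrightarrow> orbit_char g a \<noteq> 0"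
  by (simp add: orbit_char_def)

lemma orbit_char_mult:
  assumes "g \<in> carrier G" "a \<in> A" "b \<in> A"
  shows "orbit_char g (a \<otimes> b) = orbit_char g a * orbit_char g b"
  using assms by (simp add: orbit_char_def conj_by_mult twist_char conj_by_A)

lemma orbit_char_one: "g \<in> carrier G \<Longrightarrow> orbit_char g \<one> = 1"
  by (simp add: orbit_char_def twist_one)

lemma orbit_char_cocycle:
  assumes "g \<in> carrier G" "h \<in> carrier G" "a \<in> A"
  shows "orbit_char (g \<otimes> h) a = orbit_char g a * orbit_char h (conj_by G (inv g) a)"
  using assms by (simp add: orbit_char_def inv_mult_group twist_mult_left flip: conj_by_conj_by)

lemma sum_orbit_char:
  assumes "a \<in> A"
  shows "(\<Sum>g\<in>carrier G. orbit_char g a) = (if a = \<one> then of_nat (order G) else 0)"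
proof (cases "a = \<one>")
  case True
  then show ?thesis by (simp add: orbit_char_one order_def)
next
  case False
  then show ?thesis
    using twisted_class_sum[OF nondeg _ False, of "\<lambda>_. 1"] assms by (simp add: orbit_char_def)
qed

lemma order_pos: "order G > 0" using fin by (simp add: order_gt_0_iff_finite)

text \<open>A commutator in \<open>A\<close> is mapped to 1 by all characters, so that the sum of
  all \<open>orbit_char g\<close> is not 0 there. By \<open>sum_orbit_char\<close> it is the identity.\<close>

lemma A_commute:
  assumes a: "a \<in> A" and b: "b \<in> A"
  shows "a \<otimes> b = b \<otimes> a"
proof -
  define x where "x = (a \<otimes> b) \<otimes> inv (b \<otimes> a)"
  have x: "x \<in> A" using assms by (simp add: x_def)
  have "orbit_char g x = 1" if g: "g \<in> carrier G" for g
  proof -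
    have "orbit_char g (a \<otimes> b) = orbit_char g (x \<otimes> (b \<otimes> a))" using assms by (simp add: x_def m_assoc inv_mult_group)
    then have "orbit_char g a * orbit_char g b = orbit_char g x * (orbit_char g b * orbit_char g a)"
      using g x a b by (simp add: orbit_char_mult)
    then show ?thesis using orbit_char_nonzero[OF g a] orbit_char_nonzero[OF g b] by simp
  qed
  then have "x = \<one>" using sum_orbit_char[OF x] order_pos by (auto simp: order_def split: if_splits)
  then show ?thesis using assms by (simp add: x_def inv_solve_right')
qed

text \<open>By \<open>sum_orbit_char\<close> the characters \<open>orbit_char g\<close> add up to a multiple of the regular character of
  \<open>A\<close>, in which all characters occur equally often.\<close>

lemma card_orbit_char_fibre:
  assumes \<chi>: "\<And>a b. a \<in> A \<Longrightarrow> b \<in> A \<Longrightarrow> \<chi> (a \<otimes> b) = \<chi> a * \<chi> b"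
    and nz: "\<And>a. a \<in> A \<Longrightarrow> \<chi> a \<noteq> 0"
  shows "card A * card {g \<in> carrier G. \<forall>a\<in>A. orbit_char g a = \<chi> a} = order G"
proof -
  have one: "\<chi> \<one> = 1" using \<chi>[of \<one> \<one>] nz[of \<one>] by simp
  have "(\<Sum>a\<in>A. orbit_char g a / \<chi> a) = (if \<forall>a\<in>A. orbit_char g a = \<chi> a then of_nat (card A) else 0)"
    if g: "g \<in> carrier G" for g
    using sum_character[OF subgroup_axioms, of "\<lambda>a. orbit_char g a / \<chi> a"] nz by (simp add: orbit_char_mult[OF g] \<chi>)
  then have "(\<Sum>g\<in>carrier G. \<Sum>a\<in>A. orbit_char g a / \<chi> a) =
      (\<Sum>g\<in>carrier G. if \<forall>a\<in>A. orbit_char g a = \<chi> a then of_nat (card A) else 0)"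
    by (intro sum.cong refl)
  also have "\<dots> = of_nat (card A * card {g \<in> carrier G. \<forall>a\<in>A. orbit_char g a = \<chi> a})"
    using fin by (simp add: sum.If_cases Int_def)
  finally have "of_nat (card A * card {g \<in> carrier G. \<forall>a\<in>A. orbit_char g a = \<chi> a}) =
      (\<Sum>a\<in>A. (\<Sum>g\<in>carrier G. orbit_char g a) / \<chi> a)"
    by (subst (asm) sum.swap) (simp add: sum_divide_distrib)
  also have "\<dots> = (\<Sum>a\<in>A. if a = \<one> then of_nat (order G) else 0)"
    by (intro sum.cong refl) (auto simp: sum_orbit_char one)
  also have "\<dots> = of_nat (order G)" using finite_A by simp
  finally show ?thesis by (simp only: of_nat_eq_iff)
qed

text \<open>The stabilizer of the trivial character of \<open>A\<close>. It contains \<open>A\<close>, but need not be normal in \<open>G\<close>.\<close>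

definition stab :: "'a set" where
  "stab = {g \<in> carrier G. \<forall>a\<in>A. twist g a = 1}"

lemma stab_eq_orbit_char: "stab = {g \<in> carrier G. \<forall>a\<in>A. orbit_char g a = 1}"
proof (rule subset_antisym; rule subsetI)
  fix g assume "g \<in> {g \<in> carrier G. \<forall>a\<in>A. orbit_char g a = 1}"
  then have g: "g \<in> carrier G" "\<And>a. a \<in> A \<Longrightarrow> orbit_char g a = 1" by auto
  have "twist g a = 1" if "a \<in> A" for a
    using g(2)[OF conj_by_A[OF g(1) that]] g(1) that by (simp add: orbit_char_def)
  with g show "g \<in> stab" by (simp add: stab_def)
qed (auto simp: stab_def orbit_char_def conj_by_A)

lemma stabD: "g \<in> stab \<Longrightarrow> g \<in> carrier G" "g \<in> stab \<Longrightarrow> a \<in> A \<Longrightarrow> twist g a = 1"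
  by (auto simp: stab_def)

lemma card_stab: "card A * card stab = order G"
  unfolding stab_eq_orbit_char by (rule card_orbit_char_fibre) simp_all

lemma A_subset_stab: "A \<subseteq> stab"
  by (auto simp: stab_def twist_A)

lemma subgroup_stab: "subgroup stab G"
proof (rule subgroupI)
  show "stab \<subseteq> carrier G" by (auto simp: stab_def)
  show "stab \<noteq> {}" using A_subset_stab one_closed by blast
next
  fix g assume g: "g \<in> stab"
  have "twist (inv g) a = 1" if a: "a \<in> A" for a
  proof -
    have gc: "g \<in> carrier G" using g by (rule stabD)
    define b where "b = conj_by G (inv g) a"
    have b: "b \<in> A" "conj_by G g b = a" using conj_by_A gc a by (simp_all add: b_def)
    have "twist (inv g \<otimes> g) b = twist g b * twist (inv g) a"
      using twist_mult_left[of "inv g" g b] gc b by simp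
    then show ?thesis using gc b g twist_A[OF one_closed b(1)] by (simp add: stabD)
  qed
  with g show "inv g \<in> stab" by (simp add: stab_def)
next
  fix g h assume "g \<in> stab" "h \<in> stab"
  then show "g \<otimes> h \<in> stab" by (auto simp: stab_def twist_mult_left conj_by_A)
qed

lemma stab_normalized:
  assumes "g \<in> stab" "a \<in> A" shows "c (g, a) = 1"
proof -
  have g: "g \<in> carrier G" using assms(1) by (rule stabD)
  have "c (conj_by G g a, g) = 1" using conj_by_A[OF g assms(2)] g by (rule normalized)
  then show ?thesis using stabD(2)[OF assms] by (simp add: twist_def)
qed

text \<open>So on \<open>stab\<close> the cocycle is inflated from the quotient by \<open>A\<close>.\<close>

lemma stab_inflated:
  assumes "x \<in> stab" "y \<in> carrier G" "a \<in> A" "b \<in> A"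
  shows "c (a \<otimes> x, b \<otimes> y) = c (x, y)"
proof -
  have x: "x \<in> carrier G" using assms(1) by (rule stabD)
  have left: "c (d \<otimes> x, z) = c (x, z)" if "d \<in> A" "z \<in> carrier G" for d z
    using cocycle_eq[of d x z] that x normalized by simp
  have "c (x, b \<otimes> y) = c (x \<otimes> b, y)"
    using cocycle_eq[of x b y] x assms normalized stab_normalized[OF assms(1,4)] by simp
  also have "x \<otimes> b = conj_by G x b \<otimes> x" using x assms by (simp add: conj_by_mult_self)
  also have "c (conj_by G x b \<otimes> x, y) = c (x, y)" using left conj_by_A x assms by simp
  finally show ?thesis using left assms by simp
qed

text \<open>The inflated class on \<open>stab / A\<close> is nondegenerate at its central elements. Let \<open>z = \<Sum>a\<in>A. u\<^sub>a\<close>, so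
  that \<open>\<phi>\<close> below is the coefficient function of \<open>z u\<^sub>k\<close>. The sum of the conjugates of \<open>z u\<^sub>k\<close> under \<open>G\<close> is 0 by
  \<open>twisted_class_sum\<close>. Multiplying it by \<open>z\<close>, that is, adding its coefficients over the coset of \<open>k\<close>,
  removes the contribution of every \<open>g\<close> outside of \<open>stab\<close>, as different characters are orthogonal. If all
  \<open>twist g k\<close> were 1, each \<open>g \<in> stab\<close> would contribute \<open>|A|\<close>.\<close>

lemma stab_quotient_nondegenerate:
  assumes k: "k \<in> stab" "k \<notin> A" and central: "\<And>g. g \<in> stab \<Longrightarrow> conj_by G g k \<otimes> inv k \<in> A"
  shows "\<exists>g\<in>stab. twist g k \<noteq> 1"
proof (rule ccontr)
  assume "\<not> ?thesis"
  then have triv: "twist g k = 1" if "g \<in> stab" for g using that by blast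
  have kc: "k \<in> carrier G" using k(1) by (rule stabD)
  define \<phi> :: "'a \<Rightarrow> complex" where "\<phi> x = (if x \<otimes> inv k \<in> A then 1 else 0)" for x
  let ?k = "\<lambda>g. conj_by G (inv g) k"
  have split: "\<phi> (conj_by G (inv g) (b \<otimes> k)) * twist g (conj_by G (inv g) (b \<otimes> k)) =
      orbit_char g b * (\<phi> (?k g) * twist g (?k g))" if g: "g \<in> carrier G" and b: "b \<in> A" for g b
  proof -
    let ?b = "conj_by G (inv g) b"
    have b': "?b \<in> A" using g b by (simp add: conj_by_A)
    have "?b \<otimes> ?k g \<otimes> inv k \<in> A \<longleftrightarrow> ?k g \<otimes> inv k \<in> A"
    proof
      assume "?b \<otimes> ?k g \<otimes> inv k \<in> A"
      then have "inv ?b \<otimes> (?b \<otimes> ?k g \<otimes> inv k) \<in> A" using b' by simp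
      then show "?k g \<otimes> inv k \<in> A" using g b kc by (simp add: m_assoc)
    next
      assume "?k g \<otimes> inv k \<in> A"
      then have "?b \<otimes> (?k g \<otimes> inv k) \<in> A" using b' by simp
      then show "?b \<otimes> ?k g \<otimes> inv k \<in> A" using g b kc by (simp add: m_assoc)
    qed
    then show ?thesis
      using g b b' kc by (simp add: conj_by_mult twist_char \<phi>_def orbit_char_def)
  qed
  have "0 = (\<Sum>b\<in>A. \<Sum>g\<in>carrier G.
      \<phi> (conj_by G (inv g) (b \<otimes> k)) * twist g (conj_by G (inv g) (b \<otimes> k)))"
  proof (rule sum.neutral[symmetric], rule ballI)
    fix b assume b: "b \<in> A"
    have "b \<otimes> k \<noteq> \<one>"
    proof
      assume "b \<otimes> k = \<one>"
      then have "inv k = b" using b kc by (intro inv_equality) simp_all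
      then have "k = inv b" using kc by (metis inv_inv)
      with b k show False by simp
    qed
    then show "(\<Sum>g\<in>carrier G.
      \<phi> (conj_by G (inv g) (b \<otimes> k)) * twist g (conj_by G (inv g) (b \<otimes> k))) = 0"
      using b kc by (intro twisted_class_sum[OF nondeg]) simp_all
  qed
  also have "\<dots> = (\<Sum>g\<in>carrier G. \<Sum>b\<in>A. orbit_char g b * (\<phi> (?k g) * twist g (?k g)))"
    by (subst sum.swap) (intro sum.cong refl split)
  also have "\<dots> = (\<Sum>g\<in>carrier G. if g \<in> stab then of_nat (card A) else 0)"
  proof (rule sum.cong[OF refl])
    fix g assume g: "g \<in> carrier G"
    \<comment> \<open>orthogonality of \<open>orbit_char g\<close> and the trivial character\<close>
    have sp: "(\<Sum>b\<in>A. orbit_char g b) = (if g \<in> stab then of_nat (card A) else 0)"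
      using sum_character[OF subgroup_axioms orbit_char_mult[OF g]] g by (simp add: stab_eq_orbit_char)
    have "\<phi> (?k g) * twist g (?k g) = 1" if gs: "g \<in> stab"
    proof -
      have "inv g \<in> stab" using subgroup.m_inv_closed[OF subgroup_stab gs] .
      then have d: "?k g \<otimes> inv k \<in> A" by (rule central)
      have "twist g (?k g \<otimes> inv k \<otimes> k) = twist g (?k g \<otimes> inv k) * twist g k"
        by (rule twist_char[OF g d kc])
      then have "twist g (?k g) = 1" using g kc d gs triv stabD(2) by (simp add: m_assoc)
      with d show ?thesis by (simp add: \<phi>_def)
    qed
    then show "(\<Sum>b\<in>A. orbit_char g b * (\<phi> (?k g) * twist g (?k g))) = (if g \<in> stab then of_nat (card A) else 0)"
      by (simp add: sp flip: sum_distrib_right)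
  qed
  also have "\<dots> = of_nat (card A * card stab)"
    using fin by (simp add: sum.If_cases Int_def stab_def)
  finally have "card A * card stab = 0" by (metis of_nat_0_eq_iff)
  then show False using card_stab order_pos by simp
qed

text \<open>The map \<open>g \<mapsto> twist g k\<close> is a homomorphism from \<open>stab\<close> to the \<open>p\<close>-th roots of unity, which is
  trivial on the subgroup \<open>L\<close> generated by \<open>A\<close> and \<open>k\<close>. It is not trivial by
  \<open>stab_quotient_nondegenerate\<close>, so \<open>p\<close> divides the index of \<open>L\<close> in \<open>stab\<close>, while \<open>|L| = p |A|\<close>.\<close>

lemma prime_square_dvd_card_stab:
  assumes k: "k \<in> stab" "k \<notin> A" and central: "\<And>g. g \<in> stab \<Longrightarrow> conj_by G g k \<otimes> inv k \<in> A"
    and p: "Factorial_Ring.prime (p::nat)" "k [^] p \<in> A"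
  shows "p * (p * card A) dvd card stab"
proof (rule ccontr)
  assume nd: "\<not> ?thesis"
  have kc: "k \<in> carrier G" using k(1) by (rule stabD)
  let ?S = "G\<lparr>carrier := stab\<rparr>"
  interpret S: group ?S using subgroup_stab by (rule subgroup_imp_group)
  have conjS: "conj_by ?S g x = conj_by G g x" if "g \<in> stab" for g x
    using that by (simp add: conj_by_def m_inv_consistent[OF subgroup_stab])
  have invS: "inv\<^bsub>?S\<^esub> g = inv g" if "g \<in> stab" for g
    using that by (simp add: m_inv_consistent[OF subgroup_stab])
  have powS: "x [^]\<^bsub>?S\<^esub> (n::nat) = x [^] n" for x n by (simp add: nat_pow_def)
  have AS: "A \<lhd> ?S"
    using normal_restrict_supergroup[OF subgroup_stab normal_A A_subset_stab] .
  have mult: "twist (g \<otimes> h) k = twist g k * twist h k" if "g \<in> stab" "h \<in> stab" for g h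
  proof -
    have gh: "g \<in> carrier G" "h \<in> carrier G" using that by (simp_all add: stabD)
    define d where "d = conj_by G h k \<otimes> inv k"
    have d: "d \<in> A" unfolding d_def by (rule central[OF that(2)])
    have "conj_by G h k = d \<otimes> k" using gh kc by (simp add: d_def m_assoc)
    then have "twist g (conj_by G h k) = twist g k"
      using twist_char[OF gh(1) d kc] stabD(2)[OF that(1) d] by simp
    then show ?thesis using twist_mult_left[OF gh kc] by simp
  qed
  have twA: "twist a k = 1" if a: "a \<in> A" for a
  proof -
    have "conj_by G a k \<in> stab"
      using a k(1) A_subset_stab subgroup_stab unfolding conj_by_def
      by (meson subgroup.m_closed subgroup.m_inv_closed subsetD)
    then have "c (conj_by G a k, a) = 1" using a by (rule stab_normalized)
    then show ?thesis using normalized[OF a kc] by (simp add: twist_def)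
  qed
  have twk: "twist k k = 1"
    using kc by (simp add: twist_commuting conj_by_eq_self_iff)
  have tw1: "twist \<one> k = 1" using twA one_closed by blast
  have pow: "twist (g [^] (n::nat)) k = twist g k ^ n" if "g \<in> stab" for g n
    using subgroup_pow_closed[OF subgroup_stab that] that
    by (induction n) (simp_all add: tw1 mult)
  have root: "twist g k ^ p = 1" if g: "g \<in> stab" for g
  proof -
    have gc: "g \<in> carrier G" using g by (rule stabD)
    have "twist g (k [^] n) = twist g k ^ n" for n :: nat
    proof (induction n)
      case (Suc n)
      define d where "d = conj_by G g k \<otimes> inv k"
      define e where "e = conj_by G g (k [^] n) \<otimes> inv (k [^] n)"
      have d: "d \<in> A" unfolding d_def by (rule central[OF g])
      have e: "e \<in> A" unfolding e_def
        by (rule central_mod_pow[OF normal_A gc kc central[OF g]])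
      have dk: "conj_by G g k = d \<otimes> k" "conj_by G g (k [^] n) = e \<otimes> k [^] n"
        using gc kc by (simp_all add: d_def e_def m_assoc)
      have "c (conj_by G g (k [^] n), conj_by G g k) = c (k [^] n, k)"
        unfolding dk using subgroup_pow_closed[OF subgroup_stab k(1)] kc e d by (rule stab_inflated)
      then show ?case using twist_mult_right[of g "k [^] n" k] gc kc Suc by simp
    qed (simp add: twist_one gc)
    from this[of p] stabD(2)[OF g p(2)] show ?thesis by simp
  qed
  define L where "L = S.adjoin A k"
  have LS: "L \<lhd> ?S"
    unfolding L_def using k(1) p central
    by (intro S.adjoin_normal[OF AS, where p = p]) (auto simp: prime_gt_0_nat powS conjS invS)
  interpret L: normal L ?S by (rule LS)
  have cardL: "card L = p * card A"
    unfolding L_def by (rule S.card_adjoin[OF AS]) (use k p in \<open>auto simp: powS\<close>)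
  have twL: "twist x k = 1" if "x \<in> L" for x
  proof -
    from that obtain a i where x: "x = a \<otimes> k [^] (i::nat)" "a \<in> A"
      by (auto simp: L_def S.adjoin_def powS)
    then show ?thesis
      using mult[of a "k [^] i"] A_subset_stab subgroup_pow_closed[OF subgroup_stab k(1)]
        pow[OF k(1)] twk twA by auto
  qed
  define j where "j = card (rcosets\<^bsub>?S\<^esub> L)"
  have j: "j * (p * card A) = card stab"
    using S.lagrange[OF L.subgroup_axioms] by (simp add: j_def cardL order_def)
  then have "\<not> p dvd j" using nd by (metis dvd_refl mult.assoc mult_dvd_mono)
  then have cop: "coprime p j" using p(1) by (simp add: prime_imp_coprime_nat)
  obtain g where g: "g \<in> stab" "twist g k \<noteq> 1"
    using stab_quotient_nondegenerate[OF k central] by blast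
  interpret Q: group "?S Mod L" by (rule L.factorgroup_is_group)
  have "g [^] j \<in> L"
  proof -
    have "order (?S Mod L) = j" by (simp add: order_def FactGroup_def j_def)
    moreover have "L #>\<^bsub>?S\<^esub> g \<in> carrier (?S Mod L)"
      using g by (auto simp: FactGroup_def RCOSETS_def)
    ultimately have "(L #>\<^bsub>?S\<^esub> g) [^]\<^bsub>?S Mod L\<^esub> j = L"
      using Q.pow_order_eq_1[of "L #>\<^bsub>?S\<^esub> g"] by simp
    then have "L #>\<^bsub>?S\<^esub> (g [^] j) = L" using L.FactGroup_pow[of g j] g by (simp add: powS)
    moreover have "g [^] j \<in> stab" using subgroup_pow_closed[OF subgroup_stab g(1)] .
    ultimately show ?thesis using S.rcos_self[OF _ L.subgroup_axioms, of "g [^] j"] by simp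
  qed
  then have "twist g k ^ j = 1" using twL pow[OF g(1)] by metis
  moreover obtain u v where "p * u = j * v + 1"
    using bezout_nat[of p j] cop prime_gt_0_nat[OF p(1)] by auto
  ultimately have "1 = twist g k"
    using root[OF g(1)] by (metis mult_1 power_add power_mult power_one power_one_right)
  with g show False by simp
qed

text \<open>For \<open>g\<close> in the centralizer of \<open>A\<close>, \<open>twist g a\<close> is the commutator pairing of \<open>g\<close> and \<open>a\<close>, which is
  invariant under conjugation by \<open>G\<close>. This is why \<open>stab\<close> becomes normal when it is intersected with
  the centralizer.\<close>

lemma stab_centralizer_normal:
  "{g \<in> stab. \<forall>a\<in>A. conj_by G g a = a} \<lhd> G"
proof (rule normalI_conj_by)
  have "{g \<in> stab. \<forall>a\<in>A. conj_by G g a = a} = stab \<inter> {g \<in> carrier G. \<forall>a\<in>A. conj_by G g a = a}"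
    by (auto simp: stab_def)
  then show "subgroup {g \<in> stab. \<forall>a\<in>A. conj_by G g a = a} G"
    using subgroups_Inter_pair[OF subgroup_stab subgroup_stabilizer[OF subset]] by simp
next
  fix h g assume h: "h \<in> carrier G" and "g \<in> {g \<in> stab. \<forall>a\<in>A. conj_by G g a = a}"
  then have g: "g \<in> carrier G" "\<And>a. a \<in> A \<Longrightarrow> conj_by G g a = a" "\<And>a. a \<in> A \<Longrightarrow> twist g a = 1"
    by (auto simp: stab_def)
  let ?g = "conj_by G h g"
  have "conj_by G ?g a = a \<and> twist ?g a = 1" if a: "a \<in> A" for a
  proof -
    define b where "b = conj_by G (inv h) a"
    have b: "b \<in> A" "conj_by G h b = a" using h a by (simp_all add: b_def conj_by_A)
    have "conj_by G (?g \<otimes> h) b = conj_by G (h \<otimes> g) b" using h g(1) by (simp add: conj_by_mult_self)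
    then have 1: "conj_by G ?g a = a"
      using h g b by (simp flip: conj_by_conj_by)
    have "twist (?g \<otimes> h) b = twist (h \<otimes> g) b" using h g(1) by (simp add: conj_by_mult_self)
    then have "twist h b * twist ?g a = twist h b"
      using h g b by (simp add: twist_mult_left)
    then have "twist ?g a = 1" using twist_nonzero[of h b] h b(1) by simp
    with 1 show ?thesis by simp
  qed
  then show "?g \<in> {g \<in> stab. \<forall>a\<in>A. conj_by G g a = a}" using h g(1) by (simp add: stab_def)
qed

lemma centralizer_normal: "{g \<in> carrier G. \<forall>a\<in>A. conj_by G g a = a} \<lhd> G"
proof (rule normalI_conj_by)
  show "subgroup {g \<in> carrier G. \<forall>a\<in>A. conj_by G g a = a} G"
    by (rule subgroup_stabilizer[OF subset])
next
  fix h g assume h: "h \<in> carrier G" and "g \<in> {g \<in> carrier G. \<forall>a\<in>A. conj_by G g a = a}"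
  then have g: "g \<in> carrier G" "\<And>a. a \<in> A \<Longrightarrow> conj_by G g a = a" by auto
  have "conj_by G (conj_by G h g) a = a" if a: "a \<in> A" for a
  proof -
    have "conj_by G (inv h) a \<in> A" using h a by (simp add: conj_by_A)
    then have "conj_by G (conj_by G h g \<otimes> h) (conj_by G (inv h) a) = a"
      using h g a by (simp add: conj_by_mult_self flip: conj_by_conj_by)
    then show ?thesis using h g(1) a by (simp flip: conj_by_conj_by)
  qed
  then show "conj_by G h g \<in> {g \<in> carrier G. \<forall>a\<in>A. conj_by G g a = a}" using h g(1) by simp
qed

text \<open>The product of the centralizer and \<open>stab\<close> is a subgroup of order \<open>|C||stab| / |A|\<close>, which
  divides \<open>|G| = |A||stab|\<close>.\<close>

lemma card_centralizer_dvd: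
  assumes "{g \<in> stab. \<forall>a\<in>A. conj_by G g a = a} = A"
  shows "card {g \<in> carrier G. \<forall>a\<in>A. conj_by G g a = a} dvd card A * card A"
proof -
  let ?C = "{g \<in> carrier G. \<forall>a\<in>A. conj_by G g a = a}"
  have "?C \<inter> stab = A" using assms by (auto simp: stab_def)
  then have "card ?C * card stab dvd order G * card A"
    using card_mult_card_dvd[OF fin centralizer_normal subgroup_stab] by simp
  also have "order G * card A = (card A * card A) * card stab" by (simp flip: card_stab)
  finally show ?thesis using card_stab order_pos by (auto simp: dvd_times_right_cancel_iff)
qed

text \<open>The restriction of \<open>c\<close> is inflated from a cyclic group. The trivialization sends \<open>a m\<^sup>i\<close> to
  \<open>u\<^sub>a w\<^sup>i\<close> with \<open>w = \<mu> u\<^sub>m\<close>, where \<open>\<mu>\<close> is chosen such that \<open>w\<^sup>p\<close> is the basis element at \<open>m\<^sup>p \<in> A\<close>;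
  the factor \<open>s i\<close> compares \<open>u\<^sub>m\<^sup>i\<close> with the basis element at \<open>m\<^sup>i\<close>.\<close>

lemma isotropic_adjoin:
  assumes m: "m \<in> stab" "m \<notin> A" and p: "Factorial_Ring.prime (p::nat)" "m [^] p \<in> A"
    and normal: "adjoin A m \<lhd> G"
  shows "isotropic G (cohomology_class G c) (adjoin A m)"
proof -
  let ?M = "adjoin A m"
  have mc: "m \<in> carrier G" using m(1) by (rule stabD)
  have powm: "m [^] (i::nat) \<in> stab" for i using subgroup_pow_closed[OF subgroup_stab m(1)] .
  define s where "s j = (\<Prod>i<j. c (m [^] i, m))" for j :: nat
  have s_nz: "s j \<noteq> 0" for j using mc by (simp add: s_def)
  have s_add: "s (i + j) = s i * s j * c (m [^] i, m [^] j)" for i j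
  proof (induction j)
    case 0
    then show ?case using stab_normalized[OF powm one_closed] by (simp add: s_def)
  next
    case (Suc j)
    have "c (m [^] i, m [^] j) * c (m [^] (i + j), m) = c (m [^] i, m [^] Suc j) * c (m [^] j, m)"
      using cocycle_eq[of "m [^] i" "m [^] j" m] mc by (simp add: nat_pow_mult)
    with Suc show ?case by (simp add: s_def mult_ac)
  qed
  obtain \<mu> where \<mu>: "\<mu> ^ p = inverse (s p)"
    using prime_gt_0_nat[OF p(1)] complex_root_exists by blast
  have \<mu>_nz: "\<mu> \<noteq> 0" using \<mu> s_nz[of p] prime_gt_0_nat[OF p(1)] by (auto simp: power_0_left)
  define t where "t i = \<mu> ^ i * s i" for i
  have t_nz: "t i \<noteq> 0" for i using \<mu>_nz s_nz by (simp add: t_def)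
  have t_add: "t (i + j) = t i * t j * c (m [^] i, m [^] j)" for i j
    by (simp add: t_def s_add power_add)
  have t_period: "t (p + i) = t i" for i
    using normalized[OF p(2), of "m [^] i"] mc \<mu> s_nz[of p] by (simp add: t_add) (simp add: t_def)
  have t_periods: "t (p * n + i) = t i" for n i
    using t_period by (induction n) (simp_all add: add.assoc)
  have t_mod: "t i = t (i mod p)" for i
    using t_periods[of "i div p" "i mod p"] by simp
  have unique: "t i = t j" if ab: "a \<in> A" "b \<in> A" and eq: "a \<otimes> m [^] i = b \<otimes> m [^] j" for a b i j
  proof -
    have p0: "0 < p" using p(1) by (rule prime_gt_0_nat)
    obtain a' where a': "a' \<in> A" "a \<otimes> m [^] i = a' \<otimes> m [^] (i mod p)"
      using adjoin_reduce[OF normal_A mc p0 p(2) ab(1)] by metis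
    obtain b' where b': "b' \<in> A" "b \<otimes> m [^] j = b' \<otimes> m [^] (j mod p)"
      using adjoin_reduce[OF normal_A mc p0 p(2) ab(2)] by metis
    have "i mod p = j mod p"
      using prime_adjoin_unique[OF normal_A mc m(2) p a'(1) b'(1), of "i mod p" "j mod p"]
        p0 eq a'(2) b'(2) by simp
    then show ?thesis using t_mod by metis
  qed
  define f where "f x = inverse (t (SOME i. \<exists>a\<in>A. x = a \<otimes> m [^] i))" for x
  have f: "f (a \<otimes> m [^] i) = inverse (t i)" if "a \<in> A" for a i
  proof -
    let ?P = "\<lambda>j. \<exists>b\<in>A. a \<otimes> m [^] i = b \<otimes> m [^] (j::nat)"
    have "?P i" using that by blast
    then have "?P (SOME j. ?P j)" by (rule someI[of ?P])
    then have "t i = t (SOME j. ?P j)" using unique[OF that] by blast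
    then show ?thesis unfolding f_def by simp
  qed
  have "c (x, y) = f x * f y / f (x \<otimes> y)" if xy: "x \<in> ?M" "y \<in> ?M" for x y
  proof -
    obtain a i b j where x: "x = a \<otimes> m [^] (i::nat)" "a \<in> A" and y: "y = b \<otimes> m [^] (j::nat)" "b \<in> A"
      using xy by (auto simp: adjoin_def)
    obtain b' where b': "b' \<in> A" "m [^] i \<otimes> b = b' \<otimes> m [^] i"
      using pow_mult_mem[OF normal_A mc y(2)] by blast
    have "x \<otimes> y = a \<otimes> (m [^] i \<otimes> b) \<otimes> m [^] j" using x y mc by (simp add: m_assoc)
    also have "\<dots> = (a \<otimes> b') \<otimes> m [^] (i + j)" using x y mc b' by (simp add: m_assoc nat_pow_mult)
    finally have "f (x \<otimes> y) = inverse (t (i + j))" using f x b' by simp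
    moreover have "c (x, y) = c (m [^] i, m [^] j)"
      unfolding x y using powm mc x y by (intro stab_inflated) simp_all
    ultimately show ?thesis using x y t_nz by (simp add: f t_add) (simp add: divide_inverse)
  qed
  moreover have "f \<in> ?M \<rightarrow> UNIV - {0}" using t_nz by (simp add: f_def)
  ultimately have "restrict c (?M \<times> ?M) \<in> two_coboundaries (G\<lparr>carrier := ?M\<rparr>)"
    unfolding two_coboundaries_def coboundary_def
    by (intro image_eqI[of _ _ f]) (auto simp: fun_eq_iff restrict_def)
  then show ?thesis
    using isotropic_cohomology_class[OF is_group normal_imp_subgroup[OF normal] cocycle] by blast
qed

end


section \<open>Normalizing a cocycle along a normal isotropic subgroup\<close>

text \<open>Let \<open>v\<^sub>a = u\<^sub>a / f(a)\<close> be the basis of the twisted group algebra of \<open>A\<close> on which \<open>c\<close> is trivial. Every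
  \<open>x\<close> is \<open>q(x) r(x)\<close> with \<open>q(x) \<in> A\<close> and \<open>r(x)\<close> a fixed element of its coset. The new basis element at \<open>x\<close>
  is the product of \<open>v\<close> at \<open>q(x)\<close> and \<open>u\<close> at \<open>r(x)\<close>, divided by the constant \<open>f(e)\<close>; the constant makes
  it equal to \<open>v\<^sub>x\<close> for \<open>x \<in> A\<close>. In this basis multiplication by \<open>A\<close> from the left is untwisted.\<close>

lemma (in group) normalized_representative:
  assumes c: "c \<in> two_cocycles G" and A: "A \<lhd> G" and iso: "isotropic G (cohomology_class G c) A"
  obtains c' where "c' \<in> two_cocycles G" "cohomology_class G c' = cohomology_class G c"
    "\<And>a x. a \<in> A \<Longrightarrow> x \<in> carrier G \<Longrightarrow> c' (a, x) = 1"
proof -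
  interpret A: normal A G by fact
  have c_nz: "c (x, y) \<noteq> 0" if "x \<in> carrier G" "y \<in> carrier G" for x y
    using two_cocycles_nonzero[OF c that] .
  have "restrict c (A \<times> A) \<in> two_coboundaries (G\<lparr>carrier := A\<rparr>)"
    using iso isotropic_cohomology_class[OF is_group A.subgroup_axioms c] by blast
  then obtain f where f_nz: "\<And>a. a \<in> A \<Longrightarrow> f a \<noteq> 0"
    and res_c: "restrict c (A \<times> A) = coboundary (G\<lparr>carrier := A\<rparr>) f"
    by (auto simp: two_coboundaries_def Pi_def)
  have f: "c (a, b) = f a * f b / f (a \<otimes> b)" if "a \<in> A" "b \<in> A" for a b
    using fun_cong[OF res_c, of "(a, b)"] that by (simp add: coboundary_def)
  define r where "r x = (SOME y. y \<in> A #> x)" for x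
  have r: "r x \<in> A #> x" if "x \<in> carrier G" for x
    unfolding r_def using rcos_self[OF that A.subgroup_axioms] by (rule someI)
  have rc: "r x \<in> carrier G" if "x \<in> carrier G" for x
    using r[OF that] that A.subset r_coset_subset_G by blast
  have r_coset: "r (a \<otimes> x) = r x" if "a \<in> A" "x \<in> carrier G" for a x
    using that coset_mult_assoc[OF A.subset _ that(2), of a] A.rcos_const[OF is_group that(1)]
    by (simp add: r_def)
  define q where "q x = x \<otimes> inv (r x)" for x
  have q: "q x \<in> A" if x: "x \<in> carrier G" for x
  proof -
    have "r x \<otimes> inv x \<in> A" using A.rcos_module_imp[OF is_group x r[OF x]] .
    then have "inv (r x \<otimes> inv x) \<in> A" by simp
    then show ?thesis using x rc[OF x] by (simp add: q_def inv_mult_group)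
  qed
  have qr: "q x \<otimes> r x = x" if "x \<in> carrier G" for x
    using that rc by (simp add: q_def m_assoc)
  have q_mult: "q (a \<otimes> x) = a \<otimes> q x" if "a \<in> A" "x \<in> carrier G" for a x
    using that rc by (simp add: q_def r_coset m_assoc)
  define e where "e = r \<one>"
  have e: "e \<in> A" using r[of \<one>] A.subset by (simp add: e_def)
  have ra: "r a = e" if "a \<in> A" for a using r_coset[OF that, of \<one>] that by (simp add: e_def)
  define h where "h x = c (q x, r x) / (f (q x) * f e)" for x
  have h_nz: "h x \<noteq> 0" if "x \<in> carrier G" for x
    using that q rc c_nz f_nz e by (simp add: h_def)
  have ha: "h a = 1 / f a" if a: "a \<in> A" for a
    using f[OF q e, of a] qr[of a] ra[OF a] a f_nz e q by (simp add: h_def)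
  define c' where "c' = coboundary G h \<otimes>\<^bsub>Z2 G\<^esub> c"
  have "coboundary G h \<in> two_coboundaries G"
    using h_nz by (auto simp: two_coboundaries_def)
  then have "c' \<in> cohomology_class G c"
    by (auto simp: c'_def cohomology_class_def r_coset_def)
  then have "c' \<in> two_cocycles G" "cohomology_class G c' = cohomology_class G c"
    using mem_cohomology_class_iff[OF is_group c] by auto
  moreover have "c' (a, x) = 1" if a: "a \<in> A" and x: "x \<in> carrier G" for a x
  proof -
    have nz: "f a \<noteq> 0" "f (q x) \<noteq> 0" "f e \<noteq> 0" "f (a \<otimes> q x) \<noteq> 0" "c (a \<otimes> q x, r x) \<noteq> 0"
      "c (q x, r x) \<noteq> 0"
      using a q[OF x] e f_nz rc[OF x] c_nz by simp_all
    have "c (a, q x) * c (a \<otimes> q x, r x) = c (a, x) * c (q x, r x)"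
      using c a q[OF x] rc[OF x] qr[OF x] by (simp add: two_cocycles_def)
    then have "f a * f (q x) * c (a \<otimes> q x, r x) = c (a, x) * c (q x, r x) * f (a \<otimes> q x)"
      using f[OF a q[OF x]] nz by (simp add: field_simps)
    moreover have "c' (a, x) = h a * h x / h (a \<otimes> x) * c (a, x)"
      using a x by (simp add: c'_def Z2_def coboundary_def)
    moreover have "h (a \<otimes> x) = c (a \<otimes> q x, r x) / (f (a \<otimes> q x) * f e)"
      using a x by (simp add: h_def q_mult r_coset)
    moreover have "c (a, x) \<noteq> 0" using a x c_nz by simp
    moreover have "h x = c (q x, r x) / (f (q x) * f e)" by (rule h_def)
    ultimately show ?thesis
      using nz by (simp only: ha[OF a]) (simp add: field_simps)
  qed
  ultimately show thesis using that by blast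
qed

section \<open>The quotient by a normal Lagrangian\<close>

context normalized_cocycle
begin

definition characters :: "('a \<Rightarrow> complex) monoid" where
  "characters = \<lparr>carrier = {\<chi> \<in> A \<rightarrow>\<^sub>E UNIV - {0}. \<forall>a\<in>A. \<forall>b\<in>A. \<chi> (a \<otimes> b) = \<chi> a * \<chi> b},
     monoid.mult = (\<lambda>\<chi> \<theta>. \<lambda>a\<in>A. \<chi> a * \<theta> a), one = (\<lambda>a\<in>A. 1)\<rparr>"

lemma comm_group_characters: "comm_group characters"
proof (rule comm_groupI)
  fix \<chi> assume "\<chi> \<in> carrier characters"
  then have "(\<lambda>a\<in>A. inverse (\<chi> a)) \<in> carrier characters"
    "(\<lambda>a\<in>A. inverse (\<chi> a)) \<otimes>\<^bsub>characters\<^esub> \<chi> = \<one>\<^bsub>characters\<^esub>"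
    by (auto simp: characters_def fun_eq_iff restrict_def PiE_def Pi_def extensional_def)
  then show "\<exists>\<theta>\<in>carrier characters. \<theta> \<otimes>\<^bsub>characters\<^esub> \<chi> = \<one>\<^bsub>characters\<^esub>" by blast
qed (auto simp: characters_def fun_eq_iff restrict_def PiE_def Pi_def extensional_def)

text \<open>The action of \<open>G\<close> on the characters of \<open>A\<close>, extensional as the group of automorphisms requires.\<close>

definition act :: "'a \<Rightarrow> ('a \<Rightarrow> complex) \<Rightarrow> 'a \<Rightarrow> complex" where
  "act g = (\<lambda>\<chi>\<in>carrier characters. \<lambda>a\<in>A. \<chi> (conj_by G (inv g) a))"

lemma act_closed:
  "g \<in> carrier G \<Longrightarrow> \<chi> \<in> carrier characters \<Longrightarrow> act g \<chi> \<in> carrier characters"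
  using conj_by_A[of "inv g"] by (auto simp: act_def characters_def PiE_def Pi_def conj_by_mult)

lemma act_act:
  "g \<in> carrier G \<Longrightarrow> h \<in> carrier G \<Longrightarrow> \<chi> \<in> carrier characters \<Longrightarrow>
    act g (act h \<chi>) = act (g \<otimes> h) \<chi>"
  using act_closed[of h \<chi>] conj_by_A[of "inv g"]
  by (auto simp: act_def fun_eq_iff restrict_def inv_mult_group simp flip: conj_by_conj_by)

lemma act_one: "\<chi> \<in> carrier characters \<Longrightarrow> act \<one> \<chi> = \<chi>"
  by (auto simp: act_def fun_eq_iff restrict_def characters_def PiE_def extensional_def)

lemma act_auto:
  assumes g: "g \<in> carrier G" shows "act g \<in> auto characters"
proof -
  have "bij_betw (act g) (carrier characters) (carrier characters)"
    by (rule bij_betw_byWitness[of _ "act (inv g)"]) (use g in \<open>auto simp: act_closed act_act act_one\<close>)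
  moreover have "act g \<in> hom characters characters"
  proof (rule homI)
    fix \<chi> \<theta> assume *: "\<chi> \<in> carrier characters" "\<theta> \<in> carrier characters"
    interpret M: comm_group characters by (rule comm_group_characters)
    have **: "\<chi> \<otimes>\<^bsub>characters\<^esub> \<theta> \<in> carrier characters" using * by simp
    have mult: "(\<chi>' \<otimes>\<^bsub>characters\<^esub> \<theta>') = (\<lambda>a\<in>A. \<chi>' a * \<theta>' a)" for \<chi>' \<theta>'
      by (simp add: characters_def)
    show "act g (\<chi> \<otimes>\<^bsub>characters\<^esub> \<theta>) = act g \<chi> \<otimes>\<^bsub>characters\<^esub> act g \<theta>"
    proof
      fix a
      show "act g (\<chi> \<otimes>\<^bsub>characters\<^esub> \<theta>) a = (act g \<chi> \<otimes>\<^bsub>characters\<^esub> act g \<theta>) a"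
        using * ** conj_by_A[of "inv g" a] g by (simp add: act_def mult)
    qed
  qed (use g act_closed in blast)
  moreover have "act g \<in> extensional (carrier characters)" by (simp add: act_def)
  ultimately show ?thesis by (simp add: auto_def Bij_def)
qed

lemma act_hom:
  assumes "g \<in> carrier G" "h \<in> carrier G"
  shows "act (g \<otimes> h) = act g \<otimes>\<^bsub>AutoGroup characters\<^esub> act h"
proof -
  have "act g \<otimes>\<^bsub>AutoGroup characters\<^esub> act h = compose (carrier characters) (act g) (act h)"
    using act_auto[OF assms(1)] act_auto[OF assms(2)] by (auto simp: AutoGroup_def BijGroup_def auto_def)
  also have "\<dots> = act (g \<otimes> h)"
  proof
    fix \<chi> show "compose (carrier characters) (act g) (act h) \<chi> = act (g \<otimes> h) \<chi>"
      using act_act[OF assms, of \<chi>] by (simp add: compose_def) (simp add: act_def)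
  qed
  finally show ?thesis by simp
qed

lemma orbit_char_in_characters: "g \<in> carrier G \<Longrightarrow> restrict (orbit_char g) A \<in> carrier characters"
  by (simp add: characters_def orbit_char_mult orbit_char_nonzero)

lemma act_coset:
  assumes b: "b \<in> A" and g: "g \<in> carrier G" shows "act (b \<otimes> g) = act g"
proof -
  have "conj_by G (inv (b \<otimes> g)) a = conj_by G (inv g) a" if "a \<in> A" for a
  proof -
    have "conj_by G (inv b) a = a"
      using that b A_commute[of "inv b" a] by (simp add: conj_by_eq_self_iff)
    then show ?thesis using that b g by (simp add: inv_mult_group flip: conj_by_conj_by)
  qed
  then show ?thesis by (auto simp: act_def fun_eq_iff restrict_def)
qed

lemma orbit_char_coset:
  assumes b: "b \<in> A" and g: "g \<in> carrier G" and a: "a \<in> A" shows "orbit_char (b \<otimes> g) a = orbit_char g a"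
proof -
  have "conj_by G (inv b) a = a"
    using a b A_commute[of "inv b" a] by (simp add: conj_by_eq_self_iff)
  moreover have "orbit_char b a = 1" using A_subset_stab a b by (auto simp: stab_eq_orbit_char)
  ultimately show ?thesis using a b g by (simp add: orbit_char_cocycle)
qed

definition repr :: "'a set \<Rightarrow> 'a" where
  "repr X = (SOME g. g \<in> X)"

lemma repr_coset:
  assumes "g \<in> carrier G" obtains b where "b \<in> A" "repr (A #> g) = b \<otimes> g"
proof -
  have "repr (A #> g) \<in> A #> g"
    unfolding repr_def using rcos_self[OF assms subgroup_axioms] by (rule someI)
  then show thesis using that by (auto simp: r_coset_def)
qed

lemma act_repr: "g \<in> carrier G \<Longrightarrow> act (repr (A #> g)) = act g"
  by (metis repr_coset act_coset)

lemma orbit_char_repr: "g \<in> carrier G \<Longrightarrow> restrict (orbit_char (repr (A #> g))) A = restrict (orbit_char g) A"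
  by (metis (no_types, lifting) repr_coset orbit_char_coset restrict_ext)

text \<open>The orbit map \<open>g \<mapsto> orbit_char g\<close> satisfies the cocycle identity and is constant on the cosets of
  \<open>A\<close>. It is injective on them as the stabilizer of the trivial character is \<open>A\<close>, and surjective as
  the fibres over all characters have the same size.\<close>

lemma IYB_quotient:
  assumes lagr: "card A * card A = order G"
  shows "IYB_group (G Mod A)"
proof -
  have "card A * card stab = card A * card A" using card_stab lagr by simp
  then have "card stab = card A" using card_A_pos by simp
  then have stab: "stab = A"
    using card_subset_eq[of stab A] A_subset_stab fin by (simp add: stab_def)
  define \<phi> where "\<phi> X = act (repr X)" for X
  define \<pi> where "\<pi> X = restrict (orbit_char (repr X)) A" for X
  have \<phi>: "\<phi> (A #> g) = act g" if "g \<in> carrier G" for g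
    using that by (simp add: \<phi>_def act_repr)
  have \<pi>: "\<pi> (A #> g) = restrict (orbit_char g) A" if "g \<in> carrier G" for g
    using that by (simp add: \<pi>_def orbit_char_repr)
  have "bijective_cocycle (G Mod A) characters \<phi> \<pi>"
    unfolding bijective_cocycle_def
  proof (intro conjI ballI)
    show "comm_group characters" by (rule comm_group_characters)
    show "\<phi> \<in> hom (G Mod A) (AutoGroup characters)"
    proof (rule homI)
      fix X Y assume "X \<in> carrier (G Mod A)" "Y \<in> carrier (G Mod A)"
      then obtain g h where "g \<in> carrier G" "X = A #> g" "h \<in> carrier G" "Y = A #> h"
        by (auto simp: carrier_FactGroup)
      then show "\<phi> (X \<otimes>\<^bsub>G Mod A\<^esub> Y) = \<phi> X \<otimes>\<^bsub>AutoGroup characters\<^esub> \<phi> Y"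
        by (simp add: rcos_sum \<phi> act_hom)
    qed (auto simp: carrier_FactGroup \<phi> act_auto AutoGroup_def)
    show "bij_betw \<pi> (carrier (G Mod A)) (carrier characters)"
    proof (rule bij_betwI')
      fix X Y assume "X \<in> carrier (G Mod A)" "Y \<in> carrier (G Mod A)"
      then obtain g h where g: "g \<in> carrier G" "X = A #> g" and h: "h \<in> carrier G" "Y = A #> h"
        by (auto simp: carrier_FactGroup)
      have "X = Y" if "\<pi> X = \<pi> Y"
      proof -
        have eq: "orbit_char g a = orbit_char h a" if "a \<in> A" for a
          using fun_cong[OF \<open>\<pi> X = \<pi> Y\<close>, of a] that g h \<pi> by simp
        define k where "k = inv g \<otimes> h"
        have k: "k \<in> carrier G" "g \<otimes> k = h" using g h by (simp_all add: k_def)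
        have "orbit_char k a = 1" if a: "a \<in> A" for a
        proof -
          define b where "b = conj_by G g a"
          have b: "b \<in> A" "conj_by G (inv g) b = a" using a g by (simp_all add: b_def conj_by_A)
          have "orbit_char h b = orbit_char g b * orbit_char k a"
            using orbit_char_cocycle[OF g(1) k(1) b(1)] k(2) b(2) by simp
          then show ?thesis using eq[OF b(1)] orbit_char_nonzero[OF g(1) b(1)] by simp
        qed
        then have "k \<in> A" using k(1) stab by (auto simp: stab_eq_orbit_char)
        then have "conj_by G g k \<in> A" using conj_by_A g by blast
        moreover have "h = conj_by G g k \<otimes> g" using g k by (simp add: conj_by_mult_self)
        ultimately have "A #> h = A #> g"
          using g coset_mult_assoc[OF subset _ g(1), of "conj_by G g k"]
            rcos_const[OF is_group, of "conj_by G g k"] k(1) by simp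
        then show ?thesis using g h by simp
      qed
      then show "\<pi> X = \<pi> Y \<longleftrightarrow> X = Y" by blast
    next
      fix X assume "X \<in> carrier (G Mod A)"
      then show "\<pi> X \<in> carrier characters" by (auto simp: carrier_FactGroup \<pi> orbit_char_in_characters)
    next
      fix \<chi> assume \<chi>: "\<chi> \<in> carrier characters"
      have "card A * card {g \<in> carrier G. \<forall>a\<in>A. orbit_char g a = \<chi> a} = order G"
        by (rule card_orbit_char_fibre) (use \<chi> in \<open>auto simp: characters_def PiE_def Pi_def\<close>)
      then have "{g \<in> carrier G. \<forall>a\<in>A. orbit_char g a = \<chi> a} \<noteq> {}"
        using order_pos by (metis card.empty mult_0_right nat_less_le)
      then obtain g where g: "g \<in> carrier G" "\<And>a. a \<in> A \<Longrightarrow> orbit_char g a = \<chi> a" by auto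
      have "\<chi> = restrict (orbit_char g) A"
        using g \<chi> by (auto simp: characters_def fun_eq_iff restrict_def PiE_def extensional_def)
      then have "\<chi> = \<pi> (A #> g)" using \<pi> g by simp
      then show "\<exists>X\<in>carrier (G Mod A). \<chi> = \<pi> X" using g by (auto simp: carrier_FactGroup)
    qed
    fix X Y assume "X \<in> carrier (G Mod A)" "Y \<in> carrier (G Mod A)"
    then obtain g h where g: "g \<in> carrier G" "X = A #> g" and h: "h \<in> carrier G" "Y = A #> h"
      by (auto simp: carrier_FactGroup)
    have "restrict (orbit_char (g \<otimes> h)) A = (\<lambda>a\<in>A. orbit_char g a * act g (restrict (orbit_char h) A) a)"
      using g h orbit_char_in_characters[OF h(1)] conj_by_A[of "inv g"]
      by (auto simp: fun_eq_iff restrict_def act_def orbit_char_cocycle)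
    then show "\<pi> (X \<otimes>\<^bsub>G Mod A\<^esub> Y) = \<pi> X \<otimes>\<^bsub>characters\<^esub> \<phi> X (\<pi> Y)"
      using g h by (simp add: rcos_sum \<pi> \<phi>) (auto simp: characters_def fun_eq_iff restrict_def)
  qed
  moreover have "finite (carrier (G Mod A))" using fin by (simp add: carrier_FactGroup)
  ultimately show ?thesis using IYB_groupI[OF factorgroup_is_group] by blast
qed

section \<open>Maximal normal isotropic subgroups\<close>

text \<open>For the contradiction at the end, \<open>v\<close> is the exponent of \<open>p\<close> in \<open>|A|\<close>. Then \<open>|G|\<close> is divisible by
  \<open>p\<close> to the power \<open>2v + 2\<close>, the centralizer loses at most one factor \<open>p\<close>, and \<open>|A|\<^sup>2\<close>, which its order
  divides, has only \<open>2v\<close> of them.\<close>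

lemma maximal_isotropic_card:
  assumes nil: "nilpotent_group G"
    and free: "\<And>q::nat. Factorial_Ring.prime q \<Longrightarrow> \<not> q ^ 8 dvd order G"
    and max: "\<And>M. M \<lhd> G \<Longrightarrow> isotropic G (cohomology_class G c) M \<Longrightarrow> card M \<le> card A"
  shows "card A * card A = order G"
proof -
  let ?C = "{g \<in> carrier G. \<forall>a\<in>A. conj_by G g a = a}"
  let ?D = "{g \<in> stab. \<forall>a\<in>A. conj_by G g a = a}"
  have AD: "A \<subseteq> ?D" using A_subset_stab A_commute by (auto simp: conj_by_eq_self_iff)
  have "?D \<subseteq> A"
  proof (rule ccontr)
    assume nD: "\<not> ?D \<subseteq> A"
    have cl: "conj_by G s m \<in> ?D" if "s \<in> carrier G" "m \<in> ?D" for s m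
      by (rule conj_by_normal[OF stab_centralizer_normal that])
    obtain m p where m: "m \<in> ?D" "m \<notin> A" "Factorial_Ring.prime (p::nat)" "m [^] p \<in> A"
      "\<And>s. s \<in> carrier G \<Longrightarrow> conj_by G s m \<otimes> inv m \<in> A"
      using nilpotent_prime_central_mod[OF nil fin normal_A
          normal_imp_subgroup[OF stab_centralizer_normal] nD order_refl cl] by blast
    have ms: "m \<in> stab" and mc: "m \<in> carrier G" using m(1) by (auto simp: stab_def)
    have norm: "adjoin A m \<lhd> G"
      by (rule adjoin_normal[OF normal_A mc prime_gt_0_nat[OF m(3)] m(4,5)])
    have "p * card A \<le> card A"
      using max[OF norm isotropic_adjoin[OF ms m(2,3,4) norm]] card_adjoin[OF normal_A mc m(2,3,4)] by simp
    then show False using card_A_pos prime_gt_1_nat[OF m(3)] by simp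
  qed
  with AD have D: "?D = A" by blast
  have C: "card ?C dvd card A * card A" by (rule card_centralizer_dvd[OF D])
  have "stab \<subseteq> A"
  proof (rule ccontr)
    assume nS: "\<not> stab \<subseteq> A"
    have cl: "conj_by G s k \<in> stab" if "s \<in> stab" "k \<in> stab" for s k
      using that subgroup_stab unfolding conj_by_def by (meson subgroup.m_closed subgroup.m_inv_closed)
    obtain k p where k: "k \<in> stab" "k \<notin> A" "Factorial_Ring.prime (p::nat)" "k [^] p \<in> A"
      "\<And>s. s \<in> stab \<Longrightarrow> conj_by G s k \<otimes> inv k \<in> A"
      using nilpotent_prime_central_mod[OF nil fin normal_A subgroup_stab nS
          subgroup.subset[OF subgroup_stab] cl] by blast
    have "p * (p * card A) dvd card stab" by (rule prime_square_dvd_card_stab[OF k(1,2,5,3,4)])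
    then obtain s where "card stab = p * (p * card A) * s" by (rule dvdE)
    then have "order G = p ^ 2 * (card A * card A) * s"
      using card_stab by (simp add: power2_eq_square mult_ac)
    then have sq: "p ^ 2 * (card A * card A) dvd order G" by simp
    define v where "v = multiplicity p (card A)"
    define t where "t = card A div p ^ v"
    have t: "card A = p ^ v * t" unfolding t_def v_def by (simp add: multiplicity_dvd)
    have nt: "\<not> p dvd t"
      unfolding t_def v_def using card_A_pos k(3) by (intro multiplicity_decompose) auto
    \<comment> \<open>otherwise \<open>|G|\<close> would be divisible by \<open>p\<close> to the power \<open>2 + 3 + 3\<close>\<close>
    have "\<not> p ^ 3 dvd card A"
    proof
      assume "p ^ 3 dvd card A"
      then have "p ^ 2 * (p ^ 3 * p ^ 3) dvd p ^ 2 * (card A * card A)" by (intro mult_dvd_mono) auto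
      then have "p ^ 8 dvd order G" using sq by (auto simp flip: power_add intro: dvd_trans)
      with free[OF k(3)] show False by simp
    qed
    moreover have "p ^ Suc (2 * v + 1) dvd order G"
    proof -
      have "p ^ Suc (2 * v + 1) * (t * t) = p ^ 2 * (card A * card A)"
        by (simp add: t power_add power2_eq_square mult_2)
      then show ?thesis using sq by (metis dvd_mult_left)
    qed
    ultimately have "p ^ (2 * v + 1) dvd card ?C"
      using centralizer_p_part[OF nil fin normal_A A_commute k(3)] by blast
    then have "p ^ (2 * v + 1) dvd card A * card A" using C dvd_trans by blast
    moreover have "card A * card A = p ^ (2 * v) * (t * t)" by (simp add: t mult_2 power_add)
    ultimately have "p dvd t * t" using prime_gt_0_nat[OF k(3)] by simp
    with nt k(3) show False by (simp add: prime_dvd_mult_iff)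
  qed
  with A_subset_stab have "stab = A" by blast
  then show ?thesis using card_stab by simp
qed

end

lemma (in group) isotropic_trivial:
  assumes c: "c \<in> two_cocycles G"
  shows "isotropic G (cohomology_class G c) {\<one>}"
proof -
  have "restrict c ({\<one>} \<times> {\<one>}) = coboundary (G\<lparr>carrier := {\<one>}\<rparr>) (\<lambda>_. c (\<one>, \<one>))"
    using two_cocycles_nonzero[OF c, of \<one> \<one>] by (auto simp: coboundary_def fun_eq_iff restrict_def)
  moreover have "(\<lambda>_. c (\<one>, \<one>)) \<in> carrier (G\<lparr>carrier := {\<one>}\<rparr>) \<rightarrow> UNIV - {0}"
    using two_cocycles_nonzero[OF c, of \<one> \<one>] by simp
  ultimately have "restrict c ({\<one>} \<times> {\<one>}) \<in> two_coboundaries (G\<lparr>carrier := {\<one>}\<rparr>)"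
    unfolding two_coboundaries_def by blast
  then show ?thesis using isotropic_cohomology_class[OF is_group triv_subgroup c] by blast
qed

lemma (in group) normalized_cocycle_of_class:
  assumes "finite (carrier G)" and \<gamma>: "\<gamma> \<in> carrier (H2 G)" "nondegenerate G \<gamma>"
    and A: "A \<lhd> G" "isotropic G \<gamma> A"
  obtains c where "\<gamma> = cohomology_class G c" "normalized_cocycle G c A"
proof -
  obtain d where d: "d \<in> two_cocycles G" "\<gamma> = cohomology_class G d"
    using \<gamma>(1) by (auto simp: carrier_H2)
  obtain c where c: "c \<in> two_cocycles G" "cohomology_class G c = cohomology_class G d"
    "\<And>a x. a \<in> A \<Longrightarrow> x \<in> carrier G \<Longrightarrow> c (a, x) = 1"
    using normalized_representative[OF d(1) A(1)] A(2) d(2) by metis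
  have "nondegenerate_cocycle G c"
    using nondegenerate_cohomology_class[OF is_group c(1)] \<gamma>(2) d c(2) by simp
  then have "normalized_cocycle G c A"
    using assms(1) c A(1) by (simp add: normalized_cocycle_def normalized_cocycle_axioms_def
        finite_group_cocycle_def finite_group_cocycle_axioms_def is_group)
  then show thesis using that d c by metis
qed

lemma (in group) exists_normal_lagrangian:
  assumes fin: "finite (carrier G)" and nil: "nilpotent_group G"
    and free: "\<And>q::nat. Factorial_Ring.prime q \<Longrightarrow> \<not> q ^ 8 dvd order G"
    and \<gamma>: "\<gamma> \<in> carrier (H2 G)" "nondegenerate G \<gamma>"
  shows "\<exists>H. normal_lagrangian G \<gamma> H"
proof -
  let ?P = "\<lambda>H. H \<lhd> G \<and> isotropic G \<gamma> H"
  have "?P {\<one>}" using one_is_normal isotropic_trivial \<gamma>(1) by (auto simp: carrier_H2)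
  moreover have "card H \<le> card (carrier G)" if "?P H" for H
    using that fin by (intro card_mono) (auto dest: normal_imp_subgroup subgroup.subset)
  ultimately have "\<exists>A. ?P A \<and> (\<forall>M. ?P M \<longrightarrow> card M \<le> card A)"
    by (intro ex_has_greatest_nat[of ?P "{\<one>}" card "Suc (card (carrier G))"])
      (auto simp: less_Suc_eq_le)
  then obtain A where A: "?P A" and max: "\<And>M. ?P M \<Longrightarrow> card M \<le> card A"
    by (elim exE conjE) simp
  obtain c where c: "\<gamma> = cohomology_class G c" "normalized_cocycle G c A"
    using normalized_cocycle_of_class[OF fin \<gamma>] A by metis
  interpret normalized_cocycle G c A by (rule c(2))
  have "card A * card A = order G"
    by (rule maximal_isotropic_card[OF nil free max]) (use c(1) in simp_all)
  then have "real (card A) = sqrt (real (order G))"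
    by (metis of_nat_0_le_iff of_nat_mult real_sqrt_abs2 abs_of_nonneg)
  with A show ?thesis by (auto simp: normal_lagrangian_def lagrangian_def)
qed

lemma (in group) extension_of_normal_lagrangian:
  assumes fin: "finite (carrier G)" and \<gamma>: "\<gamma> \<in> carrier (H2 G)" "nondegenerate G \<gamma>"
    and H: "normal_lagrangian G \<gamma> H"
  defines "A \<equiv> \<lparr>carrier = H, monoid.mult = (\<otimes>), one = \<one>\<rparr> :: 'a monoid"
  shows "short_exact A (\<lambda>x. x) G (\<lambda>x. H #> x) (G Mod H)" "comm_group A" "IYB_group (G Mod H)"
proof -
  have norm: "H \<lhd> G" and iso: "isotropic G \<gamma> H" and card: "real (card H) = sqrt (real (order G))"
    using H by (auto simp: normal_lagrangian_def lagrangian_def)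
  obtain c where c: "\<gamma> = cohomology_class G c" "normalized_cocycle G c H"
    using normalized_cocycle_of_class[OF fin \<gamma> norm iso] by metis
  interpret normalized_cocycle G c H by (rule c(2))
  have "real (card H) * real (card H) = real (order G)" unfolding card by simp
  then have "card H * card H = order G" by (metis of_nat_eq_iff of_nat_mult)
  then show "IYB_group (G Mod H)" by (rule IYB_quotient)
  show comm: "comm_group A"
  proof (rule comm_groupI)
    fix x assume "x \<in> carrier A"
    then have "inv x \<in> carrier A" "inv x \<otimes>\<^bsub>A\<^esub> x = \<one>\<^bsub>A\<^esub>" by (simp_all add: A_def)
    then show "\<exists>y\<in>carrier A. y \<otimes>\<^bsub>A\<^esub> x = \<one>\<^bsub>A\<^esub>" by blast
  next
    fix x y assume "x \<in> carrier A" "y \<in> carrier A"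
    then show "x \<otimes>\<^bsub>A\<^esub> y = y \<otimes>\<^bsub>A\<^esub> x" by (simp add: A_def A_commute)
  qed (simp_all add: A_def m_assoc)
  have "kernel G (G Mod H) (\<lambda>x. H #> x) = H"
    using coset_join1[OF _ _ subgroup_axioms] coset_join2[OF _ subgroup_axioms] subset
    by (auto simp: kernel_def)
  moreover have "group_hom A G (\<lambda>x. x)"
    using comm by (intro group_hom.intro group_hom_axioms.intro)
      (auto simp: comm_group_def A_def hom_def is_group)
  moreover have "group_hom G (G Mod H) (\<lambda>x. H #> x)"
    by (intro group_hom.intro group_hom_axioms.intro is_group factorgroup_is_group r_coset_hom_Mod)
  ultimately show "short_exact A (\<lambda>x. x) G (\<lambda>x. H #> x) (G Mod H)"
    by (simp add: short_exact_def A_def carrier_FactGroup)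
qed

theorem theorem1p9:
  fixes G :: "('a, 'b) monoid_scheme"
  assumes "group G" and "finite (carrier G)" and "nilpotent_group G"
    and "\<And>q::nat. Factorial_Ring.prime q \<Longrightarrow> \<not> q ^ 8 dvd Coset.order G"
  shows "(\<forall>\<gamma>\<in>carrier (H2 G). nondegenerate G \<gamma> \<longrightarrow> (\<exists>H. normal_lagrangian G \<gamma> H)) \<and>
    (central_type G \<longrightarrow>
      (\<exists>(A :: 'a monoid) (Q :: 'a set monoid) i p.
        short_exact A i G p Q \<and> comm_group A \<and>
        real (Coset.order A) = sqrt (real (Coset.order G)) \<and> IYB_group Q))"
proof (intro conjI ballI impI)
  interpret group G by fact
  show ex: "\<exists>H. normal_lagrangian G \<gamma> H" if "\<gamma> \<in> carrier (H2 G)" "nondegenerate G \<gamma>" for \<gamma>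
    using exists_normal_lagrangian[OF assms(2-4) that] by blast
  assume "central_type G"
  then obtain \<gamma> where \<gamma>: "\<gamma> \<in> carrier (H2 G)" "nondegenerate G \<gamma>" by (auto simp: central_type_def)
  then obtain H where H: "normal_lagrangian G \<gamma> H" using ex by blast
  let ?A = "\<lparr>carrier = H, monoid.mult = (\<otimes>\<^bsub>G\<^esub>), one = \<one>\<^bsub>G\<^esub>\<rparr> :: 'a monoid"
  have "real (order ?A) = sqrt (real (order G))"
    using H by (simp add: normal_lagrangian_def lagrangian_def order_def)
  then show "\<exists>(A :: 'a monoid) (Q :: 'a set monoid) i p. short_exact A i G p Q \<and> comm_group A \<and>
        real (order A) = sqrt (real (order G)) \<and> IYB_group Q"
    using extension_of_normal_lagrangian[OF assms(2) \<gamma> H] by blast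
qed

end
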